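(* Let $p$ be a prime number and let $G$ be a finite $p$-group. Then $\kappa(\mathcal{P}(G)) = c\kappa(\mathcal{P}(G))$ if and only if $G$ satisfies one of the following conditions: (i) $p>3$ and $G$ is non-cyclic; (ii) $p \in \{2,3\}$ and $G$ has at least two maximal cyclic subgroups of order greater than $p$ with trivial intersection.
   Context: All graphs are undirected and simple. The power graph $\mathcal{P}(G)$ of a group $G$ is the graph whose vertices are the elements of $G$, two distinct vertices being adjacent if one of them is a power of the other in $G$. For a graph $\Gamma$, the vertex connectivity $\kappa(\Gamma)$ is the minimum number of vertices whose deletion results in a disconnected or trivial (single-vertex) subgraph of $\Gamma$. A vertex cutset of $\Gamma$ is a set $S$ of vertices such that $\Gamma - S$ is disconnected. A cyclic vertex cutset of $\Gamma$ is a vertex cutset $S$ such that $\Gamma - S$ has at least two components containing cycles. The cyclic vertex connectivity $c\kappa(\Gamma)$ is the minimum of the cardinalities of the cyclic vertex cutsets of $\Gamma$; if $\Gamma$ has no cyclic vertex cutset, $c\kappa(\Gamma)$ is taken to be infinity. A maximal cyclic subgroup of $G$ is a cyclic subgroup of $G$ not properly contained in any other cyclic subgroup of $G$. Two subgroups $H_1, H_2$ have trivial intersection if $H_1 \cap H_2 = \{e\}$, where $e$ is the identity element of $G$. "At least two maximal cyclic subgroups" means at least two distinct ones. *)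

theory Defs
  imports
    "HOL-Computational_Algebra.Primes"
    "HOL-Library.Extended_Nat"
    "HOL-Algebra.Elementary_Groups"
    "Graph_Theory.Graph_Theory"
begin

text \<open>
  Undirected simple graphs are represented, as in the Graph_Theory library, by symmetric
  loop-free digraphs without parallel arcs: an edge is a pair of opposite arcs.
\<close>

definition power_graph :: "('a, 'm) monoid_scheme \<Rightarrow> ('a, 'a \<times> 'a) pre_digraph" where
  "power_graph G = with_proj
     \<lparr> pverts = carrier G,
       parcs = {(x, y). x \<in> carrier G \<and> y \<in> carrier G \<and> x \<noteq> y \<and>
                  ((\<exists>k::int. y = x [^]\<^bsub>G\<^esub> k) \<or> (\<exists>k::int. x = y [^]\<^bsub>G\<^esub> k))} \<rparr>"

lemma graph_power_graph:
  assumes "finite (carrier G)"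
  shows "graph (power_graph G)"
proof -
  have "finite (parcs \<lparr> pverts = carrier G,
       parcs = {(x, y). x \<in> carrier G \<and> y \<in> carrier G \<and> x \<noteq> y \<and>
                  ((\<exists>k::int. y = x [^]\<^bsub>G\<^esub> k) \<or> (\<exists>k::int. x = y [^]\<^bsub>G\<^esub> k))} \<rparr>)"
    by (rule finite_subset[of _ "carrier G \<times> carrier G"]) (use assms in auto)
  then show ?thesis
    unfolding power_graph_def using assms
    by unfold_locales (auto simp: symmetric_def arc_to_ends_def intro!: symI)
qed

definition delete_verts :: "('a, 'b) pre_digraph \<Rightarrow> 'a set \<Rightarrow> ('a, 'b) pre_digraph" where
  "delete_verts \<Gamma> S = \<Gamma> \<restriction> (verts \<Gamma> - S)"

text \<open>
  In the library the empty graph is not connected; we do not count it as disconnected either.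
\<close>

definition disconnected :: "('a, 'b) pre_digraph \<Rightarrow> bool" where
  "disconnected \<Gamma> \<longleftrightarrow> verts \<Gamma> \<noteq> {} \<and> \<not> Digraph_Component.connected \<Gamma>"

definition vertex_cutset :: "('a, 'b) pre_digraph \<Rightarrow> 'a set \<Rightarrow> bool" where
  "vertex_cutset \<Gamma> S \<longleftrightarrow> S \<subseteq> verts \<Gamma> \<and> disconnected (delete_verts \<Gamma> S)"

text \<open>
  Infima in \<open>enat\<close> of nonempty sets are attained, so the infima below are minima, and
  the infimum of the empty set is \<open>\<infinity>\<close>.
\<close>

definition vertex_connectivity :: "('a, 'b) pre_digraph \<Rightarrow> enat" where
  "vertex_connectivity \<Gamma> =
     (INF S \<in> {S. finite S \<and> S \<subseteq> verts \<Gamma> \<and>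
                  (disconnected (delete_verts \<Gamma> S) \<or> card (verts (delete_verts \<Gamma> S)) = 1)}.
        enat (card S))"

text \<open>
  In a symmetric digraph the walk \<open>a, b, a\<close> is a cycle in the sense of the library, whence the
  bound on the length; for the same graphs the strongly connected components \<open>sccs\<close> are
  the connected components.
\<close>

definition contains_cycle :: "('a, 'b) pre_digraph \<Rightarrow> bool" where
  "contains_cycle \<Gamma> \<longleftrightarrow> (\<exists>c. pre_digraph.cycle \<Gamma> c \<and> 3 \<le> length c)"

definition cyclic_vertex_cutset :: "('a, 'b) pre_digraph \<Rightarrow> 'a set \<Rightarrow> bool" where
  "cyclic_vertex_cutset \<Gamma> S \<longleftrightarrow> vertex_cutset \<Gamma> S \<and>
     (\<exists>C \<in> pre_digraph.sccs (delete_verts \<Gamma> S). \<exists>D \<in> pre_digraph.sccs (delete_verts \<Gamma> S).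
        C \<noteq> D \<and> contains_cycle C \<and> contains_cycle D)"

definition cyclic_vertex_connectivity :: "('a, 'b) pre_digraph \<Rightarrow> enat" where
  "cyclic_vertex_connectivity \<Gamma> =
     (INF S \<in> {S. finite S \<and> cyclic_vertex_cutset \<Gamma> S}. enat (card S))"

definition cyclic_subgroup :: "'a set \<Rightarrow> ('a, 'm) monoid_scheme \<Rightarrow> bool" where
  "cyclic_subgroup H G \<longleftrightarrow> subgroup H G \<and> cyclic_group (G\<lparr>carrier := H\<rparr>)"

definition maximal_cyclic_subgroup :: "'a set \<Rightarrow> ('a, 'm) monoid_scheme \<Rightarrow> bool" where
  "maximal_cyclic_subgroup M G \<longleftrightarrow> cyclic_subgroup M G \<and>
     \<not> (\<exists>H. cyclic_subgroup H G \<and> M \<subset> H)"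

end

theory Submission
  imports Defs "HOL-Algebra.Group_Action" "HOL-Number_Theory.Residues"
begin

text \<open>
  The identity is adjacent to every vertex, so it lies in every cutset, and for nontrivial \<open>a\<close>, \<open>b\<close>
  the vertices \<open>a\<close> and \<open>b\<close> are separated by \<open>{1}\<close> exactly if \<open>\<langle>a\<rangle> \<inter> \<langle>b\<rangle> = 1\<close>, because any two
  elements of a cyclic \<open>p\<close>-group are powers of one another in one direction. If such \<open>a\<close>, \<open>b\<close>
  exist, the vertex connectivity is 1, and the question is whether two components of the graph
  without the identity contain cycles; a component of elements of order \<open>p\<close> is complete on \<open>p - 1\<close>
  vertices, so for \<open>p \<le> 3\<close> it needs an element of larger order.

  If no such \<open>a\<close>, \<open>b\<close> exist, then \<open>G\<close> is cyclic (complete graph, no cutset) or \<open>p = 2\<close> and \<open>G\<close> is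
  generalized quaternion with involution \<open>z\<close>. In the latter case \<open>{1, z}\<close> is a cutset contained in all
  others, and outside one cyclic subgroup all remaining vertices \<open>w\<close> have order 4, hence only the
  neighbour \<open>w\<inverse>\<close>, so at most one component has a cycle. The full classification is not needed: all that is
  used comes from comparing a maximal cyclic subgroup \<open>\<langle>x\<rangle>\<close> with an element \<open>y\<close> normalizing it
  with \<open>y\<^sup>p \<in> \<langle>x\<rangle>\<close>.
\<close>

section \<open>Finite p-groups\<close>

text \<open>Orbit sizes divide \<open>p ^ k\<close>, so every orbit that is not a single point has
  size divisible by \<open>p\<close>; if \<open>x\<close> were the only fixed point,
  \<open>card E\<close> would be 1 modulo \<open>p\<close>.\<close>

lemma (in group_action) ex_other_fixed_point:
  assumes "Factorial_Ring.prime p" "order G = p ^ k" "finite E" "p dvd card E"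
    and x: "x \<in> E" "\<And>g. g \<in> carrier G \<Longrightarrow> \<phi> g x = x"
  shows "\<exists>y\<in>E. y \<noteq> x \<and> (\<forall>g\<in>carrier G. \<phi> g y = y)"
proof (rule ccontr)
  assume no: "\<not> ?thesis"
  interpret G: group G using group_hom group_hom.axioms(1) by blast
  have orb_x: "orbit G \<phi> x = {x}"
    using x(2) G.one_closed by (auto simp: orbit_def intro!: exI[of _ "\<one>"])
  have fin: "finite (orbits G E \<phi>)"
    using assms(3) by (simp add: orbits_def setcompr_eq_image)
  have dvd: "p dvd card B" if B: "B \<in> orbits G E \<phi> - {{x}}" for B
  proof -
    obtain y where y: "y \<in> E" "B = orbit G \<phi> y"
      using B by (auto simp: orbits_def)
    have "card B dvd p ^ k"
      using orbit_stabilizer_theorem[OF y(1)] y(2) assms(2) by (metis dvd_triv_left)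
    then obtain j where j: "card B = p ^ j"
      using assms(1) divides_primepow_nat by blast
    have yB: "y \<in> B"
      using y orbit_refl by blast
    show ?thesis
    proof (cases "j = 0")
      case True
      then have "B = {y}"
        using j yB by (auto simp: card_1_singleton_iff)
      then have "\<forall>g\<in>carrier G. \<phi> g y = y"
        using y(2) unfolding orbit_def by blast
      then have "y = x"
        using no y(1) by metis
      then show ?thesis
        using B \<open>B = {y}\<close> by blast
    qed (use j in auto)
  qed
  have mem: "{x} \<in> orbits G E \<phi>"
    unfolding orbits_def using x(1) orb_x[symmetric] by blast
  have "card E = (\<Sum>B\<in>orbits G E \<phi>. card B)"
    using disjoint_sum[OF assms(3), of "\<lambda>_. 1 :: nat"] by simp
  also have "\<dots> = 1 + (\<Sum>B\<in>orbits G E \<phi> - {{x}}. card B)"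
    by (simp add: sum.remove[OF fin mem])
  finally have "p dvd 1 + (\<Sum>B\<in>orbits G E \<phi> - {{x}}. card B)"
    using assms(4) by simp
  moreover have "p dvd (\<Sum>B\<in>orbits G E \<phi> - {{x}}. card B)"
    using dvd by (rule dvd_sum)
  ultimately have "p dvd 1"
    using dvd_add_left_iff by blast
  then show False
    using assms(1) by (metis not_prime_unit)
qed

text \<open>Right translation by the inverse is a left action; restricting the map to
  \<open>rcosets H\<close> meets the extensionality that \<open>Bij\<close> demands.\<close>

lemma (in group) action_on_rcosets:
  assumes H: "subgroup H G"
  shows "group_action (G\<lparr>carrier := H\<rparr>) (rcosets H) (\<lambda>h. \<lambda>X\<in>rcosets H. X #> inv h)"
proof -
  have HG: "h \<in> carrier G" if "h \<in> H" for h
    using subgroup.mem_carrier[OF H that] .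
  have sub: "X \<subseteq> carrier G" if "X \<in> rcosets H" for X
    using rcosets_part_G[OF H] that by blast
  have closed: "X #> g \<in> rcosets H" if X: "X \<in> rcosets H" and g: "g \<in> carrier G" for X g
  proof -
    obtain a where a: "a \<in> carrier G" "X = H #> a"
      using X by (auto simp: RCOSETS_def)
    then have "X #> g = H #> (a \<otimes> g)"
      using g H by (simp add: coset_mult_assoc subgroup.subset)
    then show ?thesis
      using rcosetsI[OF _ m_closed, of H a g] a g H by (simp add: subgroup.subset)
  qed
  have bij: "(\<lambda>X\<in>rcosets H. X #> inv h) \<in> Bij (rcosets H)" if "h \<in> H" for h
    unfolding Bij_def
  proof (intro IntI CollectI)
    show "bij_betw (\<lambda>X\<in>rcosets H. X #> inv h) (rcosets H) (rcosets H)"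
      by (rule bij_betw_byWitness[where f' = "\<lambda>X. X #> h"])
         (use HG[OF that] in \<open>auto simp: closed coset_mult_assoc sub\<close>)
  qed auto
  have "(\<lambda>h. \<lambda>X\<in>rcosets H. X #> inv h) \<in> hom (G\<lparr>carrier := H\<rparr>) (BijGroup (rcosets H))"
  proof (rule homI)
    fix h assume "h \<in> carrier (G\<lparr>carrier := H\<rparr>)"
    then show "(\<lambda>X\<in>rcosets H. X #> inv h) \<in> carrier (BijGroup (rcosets H))"
      using bij by (simp add: BijGroup_def)
  next
    fix g h assume "g \<in> carrier (G\<lparr>carrier := H\<rparr>)" "h \<in> carrier (G\<lparr>carrier := H\<rparr>)"
    then have gh: "g \<in> H" "h \<in> H" by auto
    have "(X #> inv h) #> inv g = X #> inv (g \<otimes> h)" if "X \<in> rcosets H" for X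
      using that gh HG by (simp add: coset_mult_assoc sub inv_mult_group)
    then show "(\<lambda>X\<in>rcosets H. X #> inv (g \<otimes>\<^bsub>G\<lparr>carrier := H\<rparr>\<^esub> h)) =
        (\<lambda>X\<in>rcosets H. X #> inv g) \<otimes>\<^bsub>BijGroup (rcosets H)\<^esub> (\<lambda>X\<in>rcosets H. X #> inv h)"
      using gh by (auto simp: BijGroup_def compose_def bij closed HG fun_eq_iff)
  qed
  then show ?thesis
    unfolding group_action_def group_hom_def group_hom_axioms_def
    using subgroup_imp_group[OF H] group_BijGroup by blast
qed

locale finite_p_group = group G for G (structure) +
  fixes p n :: nat
  assumes prime_p: "Factorial_Ring.prime p"
    and finite_carrier: "finite (carrier G)"
    and order_eq: "order G = p ^ n"
begin

text \<open>\<open>H\<close> acts by right translation on its cosets, whose number is a positive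
  power of \<open>p\<close>, and fixes the coset \<open>H\<close>. A second fixed coset
  \<open>H #> a\<close> gives \<open>a \<otimes> h \<otimes> inv a \<in> H\<close>.\<close>

lemma normalizer_grows:
  assumes H: "subgroup H G" and "H \<noteq> carrier G"
  obtains g where "g \<in> carrier G" "g \<notin> H" "\<And>h. h \<in> H \<Longrightarrow> g \<otimes> h \<otimes> inv g \<in> H"
proof -
  have HG: "h \<in> carrier G" if "h \<in> H" for h
    using subgroup.mem_carrier[OF H that] .
  have lag: "card (rcosets H) * card H = p ^ n"
    using lagrange[OF H] order_eq by simp
  have "card H dvd p ^ n"
    using lag by (metis dvd_triv_right)
  then obtain k where k: "card H = p ^ k"
    using divides_primepow_nat[OF prime_p] by blast
  have "card (rcosets H) dvd p ^ n"
    using lag by (metis dvd_triv_left)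
  then obtain l where l: "card (rcosets H) = p ^ l"
    using divides_primepow_nat[OF prime_p] by blast
  have "l \<noteq> 0"
  proof
    assume "l = 0"
    then have "card H = card (carrier G)"
      using lag l order_eq by (simp add: order_def)
    then have "H = carrier G"
      using card_subset_eq[OF finite_carrier] H subgroup.subset by blast
    then show False using assms(2) by blast
  qed
  interpret act: group_action "G\<lparr>carrier := H\<rparr>" "rcosets H" "\<lambda>h. \<lambda>X\<in>rcosets H. X #> inv h"
    by (rule action_on_rcosets[OF H])
  have Hr: "H \<in> rcosets H"
    using subgroup.subgroup_in_rcosets[OF H is_group] .
  obtain X where X: "X \<in> rcosets H" "X \<noteq> H" "\<And>h. h \<in> H \<Longrightarrow> X #> inv h = X"
  proof -
    have "\<exists>y\<in>rcosets H. y \<noteq> H \<and> (\<forall>g\<in>carrier (G\<lparr>carrier := H\<rparr>). (\<lambda>X\<in>rcosets H. X #> inv g) y = y)"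
    proof (rule act.ex_other_fixed_point[OF prime_p, of k])
      show "order (G\<lparr>carrier := H\<rparr>) = p ^ k" by (simp add: order_def k)
      show "finite (rcosets H)"
        using l prime_p by (metis card.infinite not_prime_0 power_eq_0_iff)
      show "p dvd card (rcosets H)" using l \<open>l \<noteq> 0\<close> by simp
      show "H \<in> rcosets H" by (rule Hr)
      fix g assume "g \<in> carrier (G\<lparr>carrier := H\<rparr>)"
      then show "(\<lambda>X\<in>rcosets H. X #> inv g) H = H"
        using Hr H by (simp add: coset_join2 subgroup.m_inv_closed HG)
    qed
    then show thesis using that by (auto split: if_splits)
  qed
  obtain a where a: "a \<in> carrier G" "X = H #> a"
    using X(1) by (auto simp: RCOSETS_def)
  have "a \<notin> H"
    using a X(2) coset_join2 H by blast
  moreover have "a \<otimes> h \<otimes> inv a \<in> H" if "h \<in> H" for h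
  proof -
    have "X #> h = X"
      using X(3)[of "inv h"] that H HG by (simp add: subgroup.m_inv_closed)
    then have "H #> (a \<otimes> h) = H #> a"
      using a HG[OF that] H by (simp add: coset_mult_assoc subgroup.subset)
    moreover have "a \<otimes> h \<in> H #> (a \<otimes> h)"
      using rcos_self[OF _ H] a HG[OF that] by blast
    ultimately obtain h' where "h' \<in> H" "a \<otimes> h = h' \<otimes> a"
      by (auto simp: r_coset_def)
    then show ?thesis
      using a HG by (simp add: m_assoc)
  qed
  ultimately show thesis using that a by blast
qed

section \<open>Orders and cyclic subgroups in a finite p-group\<close>

lemma ord_prime_power: "x \<in> carrier G \<Longrightarrow> \<exists>m. ord x = p ^ m"
  using ord_dvd_group_order order_eq divides_primepow_nat[OF prime_p] by metis

lemma ord_pos: "x \<in> carrier G \<Longrightarrow> ord x \<noteq> 0"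
  using ord_ge_1[OF finite_carrier] by fastforce

lemma mem_cyclic_iff:
  "x \<in> carrier G \<Longrightarrow> y \<in> generate G {x} \<longleftrightarrow> (\<exists>k::nat. y = x [^] k)"
  using generate_pow_nat ord_pos by auto

lemma mem_cyclic_carrier:
  "x \<in> carrier G \<Longrightarrow> y \<in> generate G {x} \<Longrightarrow> y \<in> carrier G"
  using generate_in_carrier by blast

lemma cyclic_subset:
  "x \<in> carrier G \<Longrightarrow> y \<in> generate G {x} \<Longrightarrow> generate G {y} \<subseteq> generate G {x}"
  using generate_subgroup_incl[of "{y}"] generate_is_subgroup[of "{x}"] by blast

lemma self_mem_cyclic: "x \<in> generate G {x}"
  by (simp add: generate.incl)

lemma pow_mem_cyclic: "x \<in> carrier G \<Longrightarrow> x [^] (k::nat) \<in> generate G {x}"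
  using mem_cyclic_iff by blast

lemma mem_cyclic_iff_subset:
  "x \<in> carrier G \<Longrightarrow> y \<in> generate G {x} \<longleftrightarrow> generate G {y} \<subseteq> generate G {x}"
  using cyclic_subset self_mem_cyclic by blast

text \<open>By Bezout, \<open>gcd i (ord x)\<close> is a multiple of \<open>i\<close> modulo
  \<open>ord x\<close>, hence so is \<open>j\<close>.\<close>

lemma pow_mem_cyclic_pow:
  assumes "x \<in> carrier G" "gcd i (ord x) dvd j"
  shows "x [^] j \<in> generate G {x [^] (i::nat)}"
proof -
  obtain c where c: "j = gcd i (ord x) * c" using assms(2) by blast
  show ?thesis
  proof (cases "i = 0")
    case True
    then have "x [^] j = \<one>"
      using assms pow_eq_id by auto
    then show ?thesis by (simp add: generate.one)
  next
    case False
    then obtain u v where uv: "i * u = ord x * v + gcd i (ord x)"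
      using bezout_nat by blast
    have "(x [^] i) [^] (u * c) = x [^] (i * u * c)"
      using assms by (simp add: nat_pow_pow mult.assoc)
    also have "i * u * c = ord x * (v * c) + j"
      using uv c by (simp add: algebra_simps)
    also have "x [^] \<dots> = x [^] j"
      using assms by (simp add: nat_pow_mult[symmetric] nat_pow_pow[symmetric])
    finally show ?thesis
      using mem_cyclic_iff[of "x [^] i"] assms by (metis nat_pow_closed)
  qed
qed

text \<open>Both gcds with the order are powers of \<open>p\<close>, so one divides the other: the
  subgroups of a cyclic p-group form a chain. This makes every cyclic subgroup a clique of the power
  graph.\<close>

lemma cyclic_comparable:
  assumes "x \<in> carrier G" "u \<in> generate G {x}" "v \<in> generate G {x}"
  shows "u \<in> generate G {v} \<or> v \<in> generate G {u}"
proof -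
  obtain i j :: nat where ij: "u = x [^] i" "v = x [^] j"
    using assms mem_cyclic_iff by blast
  obtain m where m: "ord x = p ^ m" using ord_prime_power assms by blast
  obtain a b where ab: "gcd i (ord x) = p ^ a" "gcd j (ord x) = p ^ b"
    using divides_primepow_nat[OF prime_p] m by (metis gcd_dvd2)
  show ?thesis
  proof (cases "a \<le> b")
    case True
    then have "gcd i (ord x) dvd j"
      using ab by (metis dvd_trans gcd_dvd1 le_imp_power_dvd)
    then show ?thesis using pow_mem_cyclic_pow assms ij by blast
  next
    case False
    then have "gcd j (ord x) dvd i"
      using ab by (metis dvd_trans gcd_dvd1 le_imp_power_dvd nat_le_linear)
    then show ?thesis using pow_mem_cyclic_pow assms ij by blast
  qed
qed

lemma ord_le_of_mem_cyclic:
  assumes "x \<in> carrier G" "y \<in> generate G {x}"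
  shows "ord y \<le> ord x" and "ord y = ord x \<Longrightarrow> x \<in> generate G {y}"
proof -
  have fin: "finite (generate G {x})"
    using assms finite_carrier by (meson finite_subset generate_incl empty_subsetI insert_subset)
  have y: "y \<in> carrier G" using assms mem_cyclic_carrier by blast
  have sub: "generate G {y} \<subseteq> generate G {x}" using assms cyclic_subset by blast
  show "ord y \<le> ord x"
    using card_mono[OF fin sub] generate_pow_card assms y by simp
  assume "ord y = ord x"
  then have "generate G {y} = generate G {x}"
    using card_subset_eq[OF fin sub] generate_pow_card assms y by simp
  then show "x \<in> generate G {y}" using self_mem_cyclic by simp
qed

text \<open>Maximality of \<open>generate G {c}\<close> is phrased through generators to avoid
  quantifying over subgroups; \<open>maximal_cyclic_subgroup_generate\<close> gives the link to
  subgroups.\<close>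

definition max_cyclic :: "'a \<Rightarrow> bool" where
  "max_cyclic c \<longleftrightarrow> c \<in> carrier G \<and> (\<forall>d\<in>carrier G. c \<in> generate G {d} \<longrightarrow> d \<in> generate G {c})"

lemma ex_max_cyclic:
  assumes "x \<in> carrier G"
  obtains c where "max_cyclic c" "x \<in> generate G {c}"
proof -
  let ?A = "{c \<in> carrier G. x \<in> generate G {c}}"
  have "finite ?A" "?A \<noteq> {}"
    using finite_carrier assms self_mem_cyclic[of x] by auto
  \<comment> \<open>Any larger cyclic subgroup around \<open>c\<close> also contains
    \<open>x\<close>, so a candidate of largest order is maximal among all cyclic subgroups.\<close>
  then obtain c where c: "c \<in> ?A" "\<And>d. d \<in> ?A \<Longrightarrow> ord d \<le> ord c"
    using Max_in[of "ord ` ?A"] Max_ge[of "ord ` ?A"] by (smt (verit) empty_is_image finite_imageI image_iff)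
  have "max_cyclic c"
    unfolding max_cyclic_def
  proof (intro conjI ballI impI)
    show "c \<in> carrier G" using c by blast
    fix d assume d: "d \<in> carrier G" "c \<in> generate G {d}"
    then have "x \<in> generate G {d}" using c(1) cyclic_subset by blast
    then have "ord d \<le> ord c" using c(2) d by blast
    then show "d \<in> generate G {c}"
      using ord_le_of_mem_cyclic[OF d] by linarith
  qed
  then show thesis using c that by blast
qed

end

text \<open>With \<open>k = 1 + p * l\<close>, the power \<open>k ^ i\<close> is
  \<open>1 + p * (i * l)\<close> modulo \<open>p\<^sup>2\<close>, and the linear terms add up to
  \<open>p * l\<close> times p(p-1)/2. For odd \<open>p\<close> the last factor is a multiple of
  \<open>p\<close>, so the sum is \<open>p\<close> modulo \<open>p\<^sup>2\<close>.\<close>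

lemma geometric_sum_prime:
  fixes p k :: nat
  assumes p: "Factorial_Ring.prime p" "odd p" and k: "[k = 1] (mod p)"
  obtains t where "(\<Sum>i<p. k ^ i) = p * t" "coprime t p"
proof -
  have "k \<noteq> 0"
    using k p(1) by (metis cong_0_1_nat not_prime_1)
  then obtain l where l: "k = 1 + p * l"
    using k by (metis cong_to_1'_nat mult.commute add.commute)
  obtain h where h: "p = 2 * h + 1" using p(2) oddE by blast
  have pow: "[k ^ i = 1 + p * (i * l)] (mod p\<^sup>2)" for i
  proof (induction i)
    case (Suc i)
    have "[k ^ i * k = (1 + p * (i * l)) * k] (mod p\<^sup>2)"
      using Suc by (rule cong_scalar_right)
    also have "(1 + p * (i * l)) * k = 1 + p * (Suc i * l) + p\<^sup>2 * (i * l * l)"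
      by (simp add: l algebra_simps power2_eq_square)
    also have "[\<dots> = 1 + p * (Suc i * l)] (mod p\<^sup>2)"
      by (simp add: cong_def)
    finally show ?case by (simp add: mult.commute)
  qed auto
  have "(\<Sum>i<2 * h + 1. i) = (2 * h + 1) * h"
    by (induction h) auto
  then have gauss: "(\<Sum>i<p. i) = p * h"
    using h by simp
  have "[(\<Sum>i<p. k ^ i) = (\<Sum>i<p. 1 + p * (i * l))] (mod p\<^sup>2)"
    by (rule cong_sum) (rule pow)
  also have "(\<Sum>i<p. 1 + p * (i * l)) = p + p * (l * (\<Sum>i<p. i))"
    by (simp only: sum.distrib) (simp add: sum_distrib_left mult_ac)
  also have "\<dots> = p + p\<^sup>2 * (l * h)"
    unfolding gauss by (simp add: power2_eq_square)
  finally have sum: "[(\<Sum>i<p. k ^ i) = p] (mod p\<^sup>2)"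
    by (simp add: cong_def)
  then have "[(\<Sum>i<p. k ^ i) = p] (mod p)"
    by (rule cong_dvd_modulus_nat) simp
  then have "p dvd (\<Sum>i<p. k ^ i)"
    by (simp add: cong_def mod_eq_0_iff_dvd)
  then obtain t where t: "(\<Sum>i<p. k ^ i) = p * t" by blast
  have "[p * t = p * 1] (mod p * p)"
    using sum t by (simp add: power2_eq_square)
  then have "[t = 1] (mod p)"
    using p(1) by (metis cong_mult_lcancel_nat mult_cancel_left not_prime_0 cong_def mult_mod_right)
  then have "coprime t p"
    by (metis cong_imp_coprime coprime_1_left cong_sym)
  then show thesis using t that by blast
qed

lemma (in group) pow_eq_pow_iff_cong:
  "x \<in> carrier G \<Longrightarrow> x [^] (i::nat) = x [^] (j::nat) \<longleftrightarrow> [i = j] (mod ord x)"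
  using int_pow_eq[of x "int i" "int j"]
  by (simp add: int_pow_int cong_int_iff[symmetric] cong_iff_dvd_diff dvd_diff_commute)

section \<open>Elements acting on a cyclic subgroup by a power map\<close>

context group
begin

lemma twist_pow:
  assumes "g \<in> carrier G" "x \<in> carrier G" "g \<otimes> x = x [^] k \<otimes> g"
  shows "g \<otimes> x [^] i = x [^] (k * i :: nat) \<otimes> g"
proof (induction i)
  case (Suc i)
  have "g \<otimes> x [^] Suc i = (g \<otimes> x [^] i) \<otimes> x"
    using assms by (simp add: m_assoc)
  also have "\<dots> = x [^] (k * i) \<otimes> (g \<otimes> x)"
    using Suc assms by (simp add: m_assoc)
  also have "\<dots> = (x [^] (k * i) \<otimes> x [^] k) \<otimes> g"
    using assms by (simp add: m_assoc)
  finally show ?case using assms by (simp add: nat_pow_mult add.commute)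
qed (use assms in simp)

lemma pow_twist:
  assumes "g \<in> carrier G" "x \<in> carrier G" "g \<otimes> x = x [^] k \<otimes> g"
  shows "g [^] j \<otimes> x = x [^] (k ^ j :: nat) \<otimes> g [^] (j :: nat)"
proof (induction j)
  case (Suc j)
  have "g [^] Suc j \<otimes> x = g [^] j \<otimes> (g \<otimes> x)"
    using assms by (simp add: m_assoc)
  also have "\<dots> = (g [^] j \<otimes> x [^] k) \<otimes> g"
    using assms by (simp add: m_assoc)
  also have "\<dots> = x [^] (k ^ j * k) \<otimes> g [^] j \<otimes> g"
    using twist_pow[OF _ _ Suc, of k] assms by simp
  finally show ?case using assms by (simp add: m_assoc mult.commute)
qed (use assms in simp)

text \<open>Moving each \<open>g\<close> to the right past \<open>x [^] s\<close> multiplies the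
  exponent by another factor \<open>k\<close>, so the exponents \<open>s\<close>,
  \<open>s * k\<close>, \<open>s * k\<^sup>2\<close> and so on are collected.\<close>

lemma twist_mult_pow:
  assumes "g \<in> carrier G" "x \<in> carrier G" "g \<otimes> x = x [^] k \<otimes> g"
  shows "(x [^] s \<otimes> g) [^] j = x [^] (s * (\<Sum>i<j. k ^ i) :: nat) \<otimes> g [^] (j :: nat)"
proof (induction j)
  case (Suc j)
  let ?S = "\<Sum>i<j. k ^ i"
  have "(x [^] s \<otimes> g) [^] Suc j = x [^] (s * ?S) \<otimes> (g [^] j \<otimes> x [^] s) \<otimes> g"
    using assms Suc by (simp add: m_assoc)
  also have "\<dots> = x [^] (s * ?S) \<otimes> (x [^] (k ^ j * s) \<otimes> g [^] j) \<otimes> g"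
    using twist_pow[OF _ _ pow_twist[OF assms], of j s] assms by simp
  also have "\<dots> = (x [^] (s * ?S) \<otimes> x [^] (k ^ j * s)) \<otimes> g [^] Suc j"
    using assms by (simp add: m_assoc)
  finally show ?case
    using assms by (simp add: nat_pow_mult algebra_simps)
qed (use assms in simp)

lemma conj_pow:
  assumes "g \<in> carrier G" "x \<in> carrier G"
  shows "(g \<otimes> x \<otimes> inv g) [^] (j::nat) = g \<otimes> x [^] j \<otimes> inv g"
proof (induction j)
  case (Suc j)
  have "(g \<otimes> x \<otimes> inv g) [^] Suc j = g \<otimes> x [^] j \<otimes> (inv g \<otimes> g) \<otimes> x \<otimes> inv g"
    unfolding nat_pow_Suc Suc using assms by (simp only: m_assoc inv_closed m_closed nat_pow_closed)
  also have "\<dots> = g \<otimes> x [^] Suc j \<otimes> inv g"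
    using assms by (simp add: m_assoc)
  finally show ?case .
qed (use assms in simp)

end

section \<open>Finite p-groups in which nontrivial cyclic subgroups meet\<close>

context finite_p_group
begin

text \<open>Equivalent to having at most one subgroup of order \<open>p\<close>; its negation
  supplies two vertices that deleting the identity separates.\<close>

definition cyclics_meet :: bool where
  "cyclics_meet \<longleftrightarrow> (\<forall>a\<in>carrier G. \<forall>b\<in>carrier G. a \<noteq> \<one> \<longrightarrow> b \<noteq> \<one> \<longrightarrow>
     generate G {a} \<inter> generate G {b} \<noteq> {\<one>})"

lemma cyclics_meetD:
  assumes "cyclics_meet" "a \<in> carrier G" "b \<in> carrier G" "a \<noteq> \<one>" "b \<noteq> \<one>"
  obtains c where "c \<in> generate G {a}" "c \<in> generate G {b}" "c \<noteq> \<one>"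
  using assms generate.one[of G] unfolding cyclics_meet_def by blast

text \<open>An element of order \<open>p\<close> is a power of each of its nontrivial powers, so one
  nontrivial element common to both subgroups already brings \<open>w\<close> into
  \<open>generate G {x}\<close>.\<close>

lemma order_p_mem_cyclic:
  assumes "cyclics_meet" "w \<in> carrier G" "w [^] p = \<one>" "x \<in> carrier G" "x \<noteq> \<one>"
  shows "w \<in> generate G {x}"
proof (cases "w = \<one>")
  case False
  obtain c where c: "c \<in> generate G {w}" "c \<in> generate G {x}" "c \<noteq> \<one>"
    using cyclics_meetD assms False by metis
  obtain i :: nat where i: "c = w [^] i"
    using c(1) assms(2) mem_cyclic_iff by blast
  have "ord w dvd p" using assms pow_eq_id by blast
  then have "ord w = p"
    using False assms(2) ord_eq_1 prime_p by (metis prime_nat_iff)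
  moreover have "\<not> p dvd i"
    using c(3) i pow_eq_id assms(2) calculation by blast
  ultimately have "gcd i (ord w) = 1"
    using prime_p by (metis coprime_commute coprime_imp_gcd_eq_1 prime_imp_coprime)
  then have "w [^] (1::nat) \<in> generate G {c}"
    using pow_mem_cyclic_pow[OF assms(2), of i 1] i by simp
  then show ?thesis
    using assms c(2) cyclic_subset[OF assms(4) c(2)] by auto
qed (simp add: generate.one)

lemma p_dvd_ord:
  assumes "x \<in> carrier G" "x \<noteq> \<one>"
  shows "p dvd ord x"
proof -
  obtain m where "ord x = p ^ m" using ord_prime_power assms by blast
  moreover have "m \<noteq> 0" using calculation assms ord_eq_1 by (metis power_0)
  ultimately show ?thesis by simp
qed

lemma coprime_ord:
  assumes "x \<in> carrier G" "coprime t p"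
  shows "coprime t (ord x)"
  using ord_prime_power[OF assms(1)] assms(2) by auto

text \<open>
  If \<open>y\<close> acts on \<open>\<langle>x\<rangle>\<close> by a power \<open>k\<close> for which the norm \<open>1 + k + \<dots> + k ^ (p - 1)\<close> is \<open>p\<close> times
  a unit, then \<open>s\<close> can be chosen such that \<open>x\<^sup>s y\<close> is an element of order \<open>p\<close> outside \<open>\<langle>x\<rangle>\<close>.
\<close>
lemma norm_not_p_times_unit:
  assumes meet: "cyclics_meet" and x: "max_cyclic x" "x \<noteq> \<one>"
    and y: "y \<in> carrier G" "y \<notin> generate G {x}" "y [^] p \<in> generate G {x}"
    and twist: "y \<otimes> x = x [^] (k::nat) \<otimes> y"
    and t: "(\<Sum>i<p. k ^ i) = p * t" "coprime t p"
  shows False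
proof -
  have xG: "x \<in> carrier G" using x unfolding max_cyclic_def by blast
  obtain j :: nat where j: "y [^] p = x [^] j" using y(3) mem_cyclic_iff xG by blast
  \<comment> \<open>Otherwise \<open>y [^] p\<close> would generate \<open>generate G {x}\<close>,
    and \<open>x\<close> would be a power of \<open>y\<close>, against maximality.\<close>
  have "p dvd j"
  proof (rule ccontr)
    assume "\<not> p dvd j"
    then have "coprime j p"
      using prime_p by (metis coprime_commute prime_imp_coprime)
    then have "gcd j (ord x) = 1"
      using coprime_ord xG by (metis coprime_imp_gcd_eq_1)
    then have "x [^] (1::nat) \<in> generate G {y [^] p}"
      using pow_mem_cyclic_pow[OF xG, of j 1] j by simp
    then have "x \<in> generate G {y}"
      using cyclic_subset[OF y(1) pow_mem_cyclic[OF y(1)]] xG by auto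
    then show False using x y unfolding max_cyclic_def by blast
  qed
  then obtain r where r: "j = p * r" by blast
  let ?N = "ord x"
  obtain u where u: "[t * u = 1] (mod ?N)"
    using cong_solve_coprime_nat coprime_ord[OF xG t(2)] by auto
  \<comment> \<open>As \<open>u\<close> inverts \<open>t\<close> and \<open>ord x - 1\<close> stands
    for -1, this makes \<open>s * t + r\<close> vanish modulo \<open>ord x\<close>.\<close>
  define s where "s = u * (?N - 1) * r"
  have "[s * t + r = (t * u) * ((?N - 1) * r) + r] (mod ?N)"
    by (simp add: s_def mult_ac)
  also have "[(t * u) * ((?N - 1) * r) + r = 1 * ((?N - 1) * r) + r] (mod ?N)"
    by (intro cong_add cong_scalar_right u) simp
  also have "1 * ((?N - 1) * r) + r = ?N * r"
    using ord_pos[OF xG] by (cases ?N) auto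
  also have "[?N * r = 0] (mod ?N)" by (simp add: cong_def)
  finally have dvd: "?N dvd s * t + r" by (simp add: cong_0_iff)
  define w where "w = x [^] s \<otimes> y"
  have wG: "w \<in> carrier G" using xG y w_def by simp
  have "w [^] p = x [^] (s * (p * t)) \<otimes> x [^] (p * r)"
    unfolding w_def twist_mult_pow[OF y(1) xG twist] t(1) j r ..
  also have "\<dots> = x [^] (p * (s * t + r))"
    using xG by (simp add: nat_pow_mult algebra_simps)
  also have "\<dots> = \<one>"
    using dvd xG pow_eq_id by (metis dvd_mult)
  finally have "w \<in> generate G {x}"
    using order_p_mem_cyclic[OF meet wG] xG x by blast
  moreover have "y = inv (x [^] s) \<otimes> w"
    using xG y by (simp add: w_def m_assoc[symmetric])
  moreover have "subgroup (generate G {x}) G"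
    using generate_is_subgroup xG by simp
  ultimately have "y \<in> generate G {x}"
    using pow_mem_cyclic[OF xG, of s] by (simp add: subgroup.m_closed subgroup.m_inv_closed)
  then show False using y by blast
qed

text \<open>Repeated \<open>p\<close>-th powers of \<open>g\<close> end at the identity, so some
  step is the first to enter \<open>H\<close>; the element just before it behaves like one of order
  \<open>p\<close> modulo \<open>H\<close>.\<close>

lemma ex_last_power:
  assumes H: "subgroup H G" and g: "g \<in> carrier G" "g \<notin> H"
  obtains j where "g [^] (p ^ j) \<notin> H" "g [^] (p ^ Suc j) \<in> H"
proof -
  let ?P = "\<lambda>j. g [^] (p ^ j) \<in> H"
  have "?P n"
    using ord_dvd_group_order[OF g(1)] order_eq pow_eq_id g(1) subgroup.one_closed[OF H] by metis
  then have L: "?P (Least ?P)" "\<And>j. j < Least ?P \<Longrightarrow> \<not> ?P j"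
    by (auto intro: LeastI dest: not_less_Least)
  have "\<not> ?P 0" using g by simp
  then obtain j where "Least ?P = Suc j" using L(1) by (metis old.nat.exhaust)
  then show thesis using L that by (metis lessI)
qed

lemma normalized_generator:
  assumes "x \<in> carrier G" "g \<in> carrier G"
  shows "g \<otimes> x \<otimes> inv g \<in> generate G {x} \<longleftrightarrow> (\<exists>k::nat. g \<otimes> x = x [^] k \<otimes> g)"
proof -
  have "g \<otimes> x \<otimes> inv g = z \<longleftrightarrow> g \<otimes> x = z \<otimes> g" if "z \<in> carrier G" for z
    using assms that by (metis inv_solve_right' m_closed)
  then show ?thesis using mem_cyclic_iff assms by auto
qed

lemma ex_normalizing_element:
  assumes x: "x \<in> carrier G" and "generate G {x} \<noteq> carrier G"
  obtains y k where "y \<in> carrier G" "y \<notin> generate G {x}" "y [^] p \<in> generate G {x}"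
    "y \<otimes> x = x [^] (k::nat) \<otimes> y"
proof -
  have H: "subgroup (generate G {x}) G"
    using generate_is_subgroup x by simp
  obtain g where g: "g \<in> carrier G" "g \<notin> generate G {x}"
    "\<And>h. h \<in> generate G {x} \<Longrightarrow> g \<otimes> h \<otimes> inv g \<in> generate G {x}"
    using normalizer_grows[OF H assms(2)] by blast
  obtain k :: nat where k: "g \<otimes> x = x [^] k \<otimes> g"
    using g self_mem_cyclic normalized_generator x by blast
  obtain j where j: "g [^] (p ^ j) \<notin> generate G {x}" "g [^] (p ^ Suc j) \<in> generate G {x}"
    using ex_last_power[OF H g(1,2)] by blast
  have "(g [^] (p ^ j)) [^] p = g [^] (p ^ Suc j)"
    using g by (simp add: nat_pow_pow mult.commute)
  then show thesis
    using that[OF _ j(1) _ pow_twist[OF g(1) x k]] g(1) j(2) by simp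
qed

text \<open>Conjugation by \<open>y [^] p\<close> raises \<open>x\<close> to the power
  \<open>k ^ p\<close>, but \<open>y [^] p\<close> is a power of \<open>x\<close> and commutes with
  it. Thus \<open>k ^ p\<close> is 1 modulo \<open>ord x\<close>, a multiple of
  \<open>p\<close>.\<close>

lemma twist_exponent:
  assumes x: "x \<in> carrier G" "x \<noteq> \<one>"
    and y: "y \<in> carrier G" "y [^] p \<in> generate G {x}" "y \<otimes> x = x [^] (k::nat) \<otimes> y"
  shows "[k ^ p = 1] (mod p)"
proof -
  obtain j :: nat where "y [^] p = x [^] j" using y(2) mem_cyclic_iff x by blast
  then have "y [^] p \<otimes> x = x \<otimes> y [^] p"
    using x nat_pow_Suc2 by (metis nat_pow_Suc)
  then have "x [^] (k ^ p) \<otimes> y [^] p = x \<otimes> y [^] p"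
    using pow_twist[OF y(1) x(1) y(3)] by simp
  then have "x [^] (k ^ p) = x [^] (1::nat)"
    using x y by simp
  then have "[k ^ p = 1] (mod ord x)"
    using pow_eq_pow_iff_cong x by blast
  then show ?thesis
    using p_dvd_ord[OF x] cong_dvd_modulus_nat by blast
qed

text \<open>If a nontrivial maximal cyclic subgroup were proper, Fermat's little theorem would turn
  \<open>k ^ p\<close> = 1 into \<open>k\<close> = 1 modulo \<open>p\<close>; then the norm is
  \<open>p\<close> times a unit, which \<open>norm_not_p_times_unit\<close> excludes.\<close>

lemma cyclic_if_cyclics_meet_odd:
  assumes "cyclics_meet" "odd p"
  shows "\<exists>x\<in>carrier G. carrier G = generate G {x}"
proof (cases "carrier G = {\<one>}")
  case True
  then show ?thesis using generate_one by auto
next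
  case False
  then obtain x0 where x0: "x0 \<in> carrier G" "x0 \<noteq> \<one>" by blast
  obtain x where x: "max_cyclic x" "x0 \<in> generate G {x}" using ex_max_cyclic x0 by blast
  have xG: "x \<in> carrier G" using x max_cyclic_def by blast
  have x1: "x \<noteq> \<one>" using x x0 generate_one by auto
  have "generate G {x} = carrier G"
  proof (rule ccontr)
    assume "generate G {x} \<noteq> carrier G"
    then obtain y k where y: "y \<in> carrier G" "y \<notin> generate G {x}" "y [^] p \<in> generate G {x}"
      "y \<otimes> x = x [^] (k::nat) \<otimes> y" using ex_normalizing_element xG by blast
    have kp: "[k ^ p = 1] (mod p)" using twist_exponent xG x1 y by blast
    have "\<not> p dvd k"
      using kp prime_p by (metis cong_dvd_iff dvd_power nat_dvd_1_iff_1 not_prime_1 prime_gt_0_nat dvd_trans)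
    then have "[k ^ (p - 1) = 1] (mod p)" using fermat_theorem prime_p by blast
    then have "[k ^ (p - 1) * k = 1 * k] (mod p)" by (rule cong_scalar_right)
    then have "[k ^ p = k] (mod p)"
      using prime_gt_0_nat[OF prime_p] by (simp add: power_eq_if mult.commute)
    then have "[k = 1] (mod p)" using kp by (metis cong_sym cong_trans)
    then obtain t where "(\<Sum>i<p. k ^ i) = p * t" "coprime t p"
      using geometric_sum_prime prime_p assms(2) by blast
    then show False using norm_not_p_times_unit assms x x1 y by blast
  qed
  then show ?thesis using xG by blast
qed

section \<open>The case of the prime 2\<close>

lemma involution_unique:
  assumes "cyclics_meet" "p = 2" "a \<in> carrier G" "b \<in> carrier G" "a \<noteq> \<one>" "b \<noteq> \<one>"
    "a [^] (2::nat) = \<one>" "b [^] (2::nat) = \<one>"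
  shows "a = b"
proof -
  have "a \<in> generate G {b}" using order_p_mem_cyclic assms by blast
  then obtain i :: nat where i: "a = b [^] i" using mem_cyclic_iff assms by blast
  then have "odd i" using assms by (metis evenE nat_pow_one nat_pow_pow)
  then obtain l where l: "i = 2 * l + 1" using oddE by blast
  have "b [^] i = (b [^] (2::nat)) [^] l \<otimes> b"
    unfolding l using assms(4) by (simp add: nat_pow_pow)
  then show ?thesis using i assms by simp
qed

text \<open>
  That \<open>x\<^sup>k\<close> is the inverse of \<open>x\<close> follows since \<open>y\<^sup>2\<close> and \<open>(x y)\<^sup>2 = x\<^bsup>1 + k\<^esup> y\<^sup>2\<close> are both the unique
  involution.
\<close>
lemma quaternion_relations:
  assumes meet: "cyclics_meet" "p = 2" and x: "max_cyclic x" "x \<noteq> \<one>"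
    and y: "y \<in> carrier G" "y \<notin> generate G {x}" "y [^] (2::nat) \<in> generate G {x}"
      "y \<otimes> x = x [^] (k::nat) \<otimes> y"
  shows "x [^] k = inv x" "y [^] (4::nat) = \<one>" "y [^] (2::nat) \<noteq> \<one>" "x [^] (2::nat) \<noteq> \<one>"
proof -
  have xG: "x \<in> carrier G" using x max_cyclic_def by blast
  have gen: "subgroup (generate G {x}) G"
    using generate_is_subgroup xG by simp
  have "[k ^ 2 = 1] (mod 2)" using twist_exponent[OF xG x(2) y(1) _ y(4)] y(3) meet(2) by simp
  then have "odd (k ^ 2)" using cong_dvd_iff[of "k ^ 2" 1 2] by simp
  then have "odd k" by simp
  \<comment> \<open>For \<open>p = 2\<close> the norm is \<open>1 + k\<close>, which is twice an odd
    number when \<open>k\<close> is 1 modulo 4.\<close>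
  have "k mod 4 \<noteq> 1"
  proof
    assume "k mod 4 = 1"
    then obtain t where t: "k = 4 * t + 1" by (metis mult_div_mod_eq)
    have "(\<Sum>i<p. k ^ i) = p * (2 * t + 1)" by (simp add: meet(2) t numeral_2_eq_2)
    moreover have "coprime (2 * t + 1) p" by (simp add: meet(2))
    ultimately show False
      using norm_not_p_times_unit[OF meet(1) x y(1,2) _ y(4)] y(3) meet(2) by blast
  qed
  then have "k mod 4 = 3" using \<open>odd k\<close> by presburger
  then obtain q where q: "k = 4 * q + 3" by (metis mult_div_mod_eq)
  \<comment> \<open>If \<open>x\<close> were an involution, the odd exponent \<open>k\<close> could
    be replaced by 1, whose norm is 2 times the unit 1.\<close>
  show x2: "x [^] (2::nat) \<noteq> \<one>"
  proof
    assume x2: "x [^] (2::nat) = \<one>"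
    have "k = 2 * (2 * q + 1) + 1" by (simp add: q)
    then have "x [^] k = (x [^] (2::nat)) [^] (2 * q + 1) \<otimes> x [^] (1::nat)"
      using xG by (simp only: nat_pow_pow nat_pow_mult nat_pow_closed)
    then have "y \<otimes> x = x [^] (1::nat) \<otimes> y" using y(4) x2 xG by simp
    moreover have "(\<Sum>i<p. 1 ^ i) = p * 1" by simp
    ultimately show False
      using norm_not_p_times_unit[OF meet(1) x y(1,2), of 1 1] y(3) meet(2) by simp
  qed
  \<comment> \<open>Stated for arbitrary \<open>w\<close> because it serves for \<open>y\<close> and
    for \<open>x \<otimes> y\<close>. Since \<open>w\<close> commutes with its square
    \<open>x [^] j\<close>, \<open>ord x\<close> divides \<open>(k - 1) * j\<close>; and
    \<open>k - 1\<close> is twice an odd number, so \<open>x [^] (2 * j)\<close> is trivial.\<close>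
  have four: "w [^] (4::nat) = \<one>" "w [^] (2::nat) \<noteq> \<one>"
    if w: "w \<in> carrier G" "w \<notin> generate G {x}" "w [^] (2::nat) \<in> generate G {x}"
      "w \<otimes> x = x [^] k \<otimes> w" for w
  proof -
    show "w [^] (2::nat) \<noteq> \<one>"
      using order_p_mem_cyclic meet w(1,2) xG x(2) by blast
    obtain j :: nat where j: "w [^] (2::nat) = x [^] j"
      using w(3) mem_cyclic_iff xG by blast
    have "x [^] (k * j) \<otimes> w = w \<otimes> w [^] (2::nat)"
      using twist_pow[OF w(1) xG w(4)] j by simp
    also have "\<dots> = w [^] (2::nat) \<otimes> w"
      using w(1) by (metis nat_pow_Suc nat_pow_Suc2)
    also have "\<dots> = x [^] j \<otimes> w" using j by simp
    finally have "x [^] (k * j) = x [^] j" using xG w(1) by simp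
    then have "[k * j = 0 + j] (mod ord x)" using pow_eq_pow_iff_cong xG by simp
    moreover have "k * j = (2 * q + 1) * (2 * j) + j" by (simp add: q algebra_simps)
    ultimately have "[(2 * q + 1) * (2 * j) = 0] (mod ord x)"
      by (metis cong_add_rcancel_nat)
    then have "ord x dvd (2 * q + 1) * (2 * j)" by (simp add: cong_0_iff)
    moreover have "coprime (ord x) (2 * q + 1)"
      using coprime_ord[OF xG, of "2 * q + 1"] meet(2) by (simp add: coprime_commute)
    ultimately have "ord x dvd 2 * j" using coprime_dvd_mult_right_iff by blast
    then have "x [^] (j * 2) = \<one>" using xG pow_eq_id by (simp add: mult.commute)
    then have "(w [^] (2::nat)) [^] (2::nat) = \<one>" using j xG by (simp add: nat_pow_pow)
    then show "w [^] (4::nat) = \<one>" using w(1) by (simp add: nat_pow_pow)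
  qed
  show y4: "y [^] (4::nat) = \<one>" and y2: "y [^] (2::nat) \<noteq> \<one>"
    using four[OF y] by auto
  define w where "w = x \<otimes> y"
  have wG: "w \<in> carrier G" using xG y w_def by simp
  have wx: "w \<notin> generate G {x}"
  proof
    assume "w \<in> generate G {x}"
    moreover have "y = inv x \<otimes> w" using xG y by (simp add: w_def m_assoc[symmetric])
    ultimately show False
      using y(2) gen self_mem_cyclic by (metis subgroup.m_closed subgroup.m_inv_closed)
  qed
  have w2: "w [^] (2::nat) = x [^] (1 + k) \<otimes> y [^] (2::nat)"
    using twist_mult_pow[OF y(1) xG y(4), of 1 2] xG y by (simp add: w_def numeral_2_eq_2)
  have "w [^] (2::nat) \<in> generate G {x}"
    unfolding w2 using gen y(3) pow_mem_cyclic[OF xG] subgroup.m_closed by metis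
  moreover have "w \<otimes> x = x [^] k \<otimes> w"
  proof -
    have "w \<otimes> x = x \<otimes> x [^] k \<otimes> y" using xG y by (simp add: w_def m_assoc)
    also have "x \<otimes> x [^] k = x [^] k \<otimes> x" using xG by (metis nat_pow_Suc nat_pow_Suc2)
    finally show ?thesis using xG y by (simp add: w_def m_assoc)
  qed
  ultimately have "w [^] (4::nat) = \<one>" "w [^] (2::nat) \<noteq> \<one>" using four wG wx by auto
  then have "w [^] (2::nat) = y [^] (2::nat)"
    using involution_unique[OF meet, of "w [^] (2::nat)" "y [^] (2::nat)"] y4 y2 wG y(1)
    by (simp add: nat_pow_pow)
  then have "x [^] (1 + k) = \<one>" using w2 xG y(1) by simp
  then have "x [^] k \<otimes> x = \<one>" using xG by (simp add: nat_pow_mult[symmetric])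
  then show "x [^] k = inv x" using xG by (metis inv_equality nat_pow_closed)
qed

text \<open>
  Were \<open>v = u\<^sup>2\<close> to invert \<open>x\<close>, then \<open>u\<close> would act by some \<open>l\<close> with \<open>l\<^sup>2 = -1\<close> modulo 4; so in the
  normalizer \<open>N\<close> of \<open>\<langle>x\<rangle>\<close> everything outside \<open>\<langle>x\<rangle>\<close> has order 4. Hence \<open>\<langle>x\<rangle>\<close> is characteristic in \<open>N\<close>,
  which forces \<open>N = G\<close>.
\<close>
lemma pow_four_outside_max_cyclic:
  assumes meet: "cyclics_meet" "p = 2" and x: "max_cyclic x" "x [^] (4::nat) \<noteq> \<one>"
    and w: "w \<in> carrier G" "w \<notin> generate G {x}"
  shows "w [^] (4::nat) = \<one>"
proof -
  have xG: "x \<in> carrier G" using x max_cyclic_def by blast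
  have x1: "x \<noteq> \<one>" using x(2) by auto
  have gen: "subgroup (generate G {x}) G"
    using generate_is_subgroup xG by simp
  \<comment> \<open>\<open>N\<close> is the normalizer of \<open>generate G {x}\<close>, described
    by the action on the generator.\<close>
  define N where "N = {g \<in> carrier G. \<exists>k::nat. g \<otimes> x = x [^] k \<otimes> g}"
  have mult: "g \<otimes> h \<in> N" if gh: "g \<in> N" "h \<in> N" for g h
  proof -
    obtain k l :: nat where kl: "g \<otimes> x = x [^] k \<otimes> g" "h \<otimes> x = x [^] l \<otimes> h"
      using gh N_def by auto
    have G: "g \<in> carrier G" "h \<in> carrier G" using gh N_def by auto
    have "g \<otimes> h \<otimes> x = (g \<otimes> x [^] l) \<otimes> h" using kl G xG by (simp add: m_assoc)
    also have "\<dots> = x [^] (k * l) \<otimes> (g \<otimes> h)"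
      using twist_pow[OF G(1) xG kl(1)] G xG by (simp add: m_assoc)
    finally show ?thesis using G N_def by auto
  qed
  have pow: "g [^] (j::nat) \<in> N" if "g \<in> N" for g j
    using that pow_twist[OF _ xG] by (auto simp: N_def)
  have N: "subgroup N G"
  proof (rule subgroupI)
    show "N \<subseteq> carrier G" by (auto simp: N_def)
    show "N \<noteq> {}" using pow self_mem_cyclic xG by (auto simp: N_def intro!: exI[of _ \<one>] exI[of _ "1::nat"])
    show "inv g \<in> N" if "g \<in> N" for g
    proof -
      have g: "g \<in> carrier G" using that N_def by auto
      have "g [^] (ord g - 1) \<otimes> g = g [^] ord g"
        using ord_pos[OF g] g by (metis Suc_diff_1 gr0I nat_pow_Suc)
      then have "inv g = g [^] (ord g - 1)" using g by (simp add: inv_equality)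
      then show ?thesis using pow that by simp
    qed
  qed (rule mult)
  have out: "v [^] (4::nat) = \<one>" if v: "v \<in> N" "v \<notin> generate G {x}" for v
  proof -
    have vG: "v \<in> carrier G" using v N_def by auto
    obtain j where j: "v [^] (2 ^ j :: nat) \<notin> generate G {x}" "v [^] (2 ^ Suc j :: nat) \<in> generate G {x}"
      using ex_last_power[OF gen vG v(2)] meet(2) by auto
    show ?thesis
    proof (cases j)
      case 0
      obtain k :: nat where "v \<otimes> x = x [^] k \<otimes> v" using v N_def by auto
      then show ?thesis
        using quaternion_relations(2)[OF meet x(1) x1 vG v(2)] j(2) 0 by simp
    next
      case (Suc i)
      define u where "u = v [^] (2 ^ i :: nat)"
      have u: "u \<in> N" "u \<in> carrier G" using pow v vG u_def by auto
      obtain l :: nat where l: "u \<otimes> x = x [^] l \<otimes> u" using u N_def by auto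
      have "u [^] (2::nat) \<notin> generate G {x}" "(u [^] (2::nat)) [^] (2::nat) \<in> generate G {x}"
        using j vG unfolding Suc u_def by (simp_all add: nat_pow_pow mult_ac)
      then have "x [^] (l ^ 2) = inv x" and x2: "x [^] (2::nat) \<noteq> \<one>"
        using quaternion_relations(1,4)[OF meet x(1) x1 _ _ _ pow_twist[OF u(2) xG l]] u(2) by auto
      then have "x [^] (l ^ 2 + 1) = \<one>" using xG by simp
      then have dvd: "ord x dvd l ^ 2 + 1" using pow_eq_id xG by blast
      obtain m where m: "ord x = 2 ^ m" using ord_prime_power meet(2) xG by blast
      \<comment> \<open>This makes 4 a divisor of \<open>ord x\<close>, so \<open>l ^ 2 + 1\<close>
        would vanish modulo 4, where squares are only 0 or 1.\<close>
      have "\<not> m \<le> 1"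
      proof
        assume "m \<le> 1"
        then have "ord x dvd 2" unfolding m by (metis le_imp_power_dvd power_one_right)
        then show False using x2 pow_eq_id xG by blast
      qed
      then have "2 ^ 2 dvd ord x" unfolding m by (intro le_imp_power_dvd) simp
      then have "4 dvd l ^ 2 + 1" using dvd by (simp add: dvd_trans)
      then have "(l ^ 2 + 1) mod 4 = 0" by simp
      moreover have "l mod 4 \<in> {0, 1, 2, 3}" by auto
      then have "(l ^ 2 + 1) mod 4 \<noteq> 0"
        unfolding power2_eq_square by (auto simp: mod_Suc mod_mult_eq[of l 4 l, symmetric])
      ultimately show ?thesis by simp
    qed
  qed
  have "N = carrier G"
  proof (rule ccontr)
    assume "N \<noteq> carrier G"
    then obtain g where g: "g \<in> carrier G" "g \<notin> N" "\<And>h. h \<in> N \<Longrightarrow> g \<otimes> h \<otimes> inv g \<in> N"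
      using normalizer_grows[OF N] by blast
    have "x \<in> N" using xG by (auto simp: N_def intro!: exI[of _ "1::nat"])
    then have u: "g \<otimes> x \<otimes> inv g \<in> N" using g by blast
    \<comment> \<open>The conjugate lies in \<open>N\<close> and, like \<open>x\<close>, has
      nontrivial fourth power, so \<open>out\<close> puts it into \<open>generate G {x}\<close> and
      thereby \<open>g\<close> into \<open>N\<close>.\<close>
    have "(g \<otimes> x \<otimes> inv g) [^] (4::nat) \<noteq> \<one>"
    proof
      assume "(g \<otimes> x \<otimes> inv g) [^] (4::nat) = \<one>"
      then have "g \<otimes> x [^] (4::nat) \<otimes> inv g = \<one>" using conj_pow g xG by simp
      then have "g \<otimes> x [^] (4::nat) = g" using g xG by (metis inv_solve_right' l_one m_closed nat_pow_closed one_closed)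
      then show False using x(2) g xG by (metis l_cancel_one nat_pow_closed r_cancel_one)
    qed
    then have "g \<otimes> x \<otimes> inv g \<in> generate G {x}" using out u by blast
    then show False using normalized_generator[OF xG g(1)] g N_def by blast
  qed
  then show ?thesis using out w by blast
qed

text \<open>If some element has nontrivial fourth power, a maximal cyclic subgroup above it is
  taken; otherwise the trivial subgroup serves.\<close>

lemma ex_cyclic_pow_four_outside:
  assumes "cyclics_meet" "p = 2"
  obtains c where "c \<in> carrier G"
    "\<And>w. w \<in> carrier G \<Longrightarrow> w \<notin> generate G {c} \<Longrightarrow> w [^] (4::nat) = \<one>"
proof (cases "\<forall>w\<in>carrier G. w [^] (4::nat) = \<one>")
  case False
  then obtain x0 where x0: "x0 \<in> carrier G" "x0 [^] (4::nat) \<noteq> \<one>" by blast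
  obtain x where x: "max_cyclic x" "x0 \<in> generate G {x}" using ex_max_cyclic x0 by blast
  have xG: "x \<in> carrier G" using x max_cyclic_def by blast
  obtain i :: nat where i: "x0 = x [^] i" using x mem_cyclic_iff xG by blast
  have "x [^] (4::nat) \<noteq> \<one>"
  proof
    assume "x [^] (4::nat) = \<one>"
    then have "(x [^] (4::nat)) [^] i = \<one>" by simp
    then have "x0 [^] (4::nat) = \<one>" using i xG by (simp add: nat_pow_pow mult.commute)
    then show False using x0 by blast
  qed
  then show thesis using that[OF xG] pow_four_outside_max_cyclic assms x by blast
qed (use that[of \<one>] in blast)

end

section \<open>Components and cycles of symmetric digraphs\<close>

context sym_digraph
begin

lemma connected_iff_reachable:
  "Digraph_Component.connected G \<longleftrightarrow> verts G \<noteq> {} \<and> (\<forall>u\<in>verts G. \<forall>v\<in>verts G. u \<rightarrow>\<^sup>* v)"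
  by (simp add: connected_def strongly_connected_def reachable_mk_symmetric_eq[OF sym_arcs])

lemma not_disconnected_if_dominating:
  assumes "d \<in> verts G" "\<And>v. v \<in> verts G \<Longrightarrow> v \<noteq> d \<Longrightarrow> d \<rightarrow> v"
  shows "\<not> disconnected G"
proof -
  have "d \<rightarrow>\<^sup>* v" if "v \<in> verts G" for v
    using assms that by (cases "v = d") auto
  then show ?thesis
    unfolding disconnected_def connected_iff_reachable
    by (meson assms(1) reachable_trans symmetric_reachable')
qed

lemma reachable_invariant:
  assumes "u \<rightarrow>\<^sup>* v" "P u" "\<And>x y. x \<rightarrow> y \<Longrightarrow> P x \<Longrightarrow> P y"
  shows "P v"
  using assms(1) by (induction rule: reachable_induct) (use assms in auto)

lemma ex_scc_with_triangle:
  assumes "a \<rightarrow> b" "b \<rightarrow> c" "c \<rightarrow> a" "distinct [a, b, c]"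
  shows "\<exists>C\<in>sccs. a \<in> verts C \<and> contains_cycle C"
proof -
  \<comment> \<open>The vertices reachable from \<open>a\<close> induce its strongly connected
    component, arcs being symmetric.\<close>
  define C where "C = G \<restriction> {v. a \<rightarrow>\<^sup>* v}"
  have a: "a \<in> verts G" using assms(1) adj_in_verts by blast
  have ab: "a \<rightarrow>\<^sup>* b" using assms by simp
  have ac: "a \<rightarrow>\<^sup>* c" using assms by (meson reachable_adjI reachable_trans)
  obtain e1 where e1: "e1 \<in> arcs G" "tail G e1 = a" "head G e1 = b" using assms(1) by blast
  obtain e2 where e2: "e2 \<in> arcs G" "tail G e2 = b" "head G e2 = c" using assms(2) by blast
  obtain e3 where e3: "e3 \<in> arcs G" "tail G e3 = c" "head G e3 = a" using assms(3) by blast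
  have "pre_digraph.cycle C [e1, e2, e3]"
    unfolding pre_digraph.cycle_def pre_digraph.awalk_def
    using e1 e2 e3 a ab ac assms(4)
    by (auto simp: C_def pre_digraph.cas.simps pre_digraph.awalk_verts.simps intro!: exI[of _ a])
  then have "contains_cycle C"
    unfolding contains_cycle_def by (intro exI[of _ "[e1, e2, e3]"]) simp
  moreover have "C \<in> sccs" unfolding C_def using a by (rule induce_reachable_is_in_sccs)
  moreover have "a \<in> verts C" using a by (simp add: C_def)
  ultimately show ?thesis by blast
qed

text \<open>All that later arguments need from a cycle is a path through three distinct
  vertices.\<close>

lemma ex_path_in_cyclic_scc:
  assumes "C \<in> sccs" "contains_cycle C"
  obtains u v w where "u \<in> verts C" "v \<in> verts C" "w \<in> verts C" "distinct [u, v, w]" "u \<rightarrow> v" "v \<rightarrow> w"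
proof -
  have sub: "subgraph C G" using assms(1) in_sccs_imp_induced induced_imp_subgraph by blast
  interpret C: wf_digraph C using sub by auto
  obtain c where c: "C.cycle c" "3 \<le> length c" using assms(2) contains_cycle_def by blast
  obtain e1 e2 e3 r where cr: "c = e1 # e2 # e3 # r"
    using c(2) by (auto simp: numeral_3_eq_3 Suc_le_length_iff)
  obtain x where x: "C.awalk x c x" "distinct (tl (C.awalk_verts x c))"
    using c(1) unfolding C.cycle_def by blast
  have arcs: "e2 \<in> arcs C" "e3 \<in> arcs C" using x(1) by (auto simp: C.awalk_def cr)
  have h2: "head C e2 = tail C e3" and rest: "C.cas (head C e3) r x"
    using x(1) by (auto simp: C.awalk_def cr)
  \<comment> \<open>\<open>cycle\<close> asserts distinctness only for the tail of the vertex list,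
    hence the path starts at \<open>e2\<close>; for length 3 the head of \<open>e3\<close> is the
    repeated starting point.\<close>
  have "head C e3 \<in> set (C.awalk_verts (head C e3) r)"
    using C.awhd_if_cas[OF rest] by (metis C.awalk_verts_non_Nil list.set_sel(1))
  then have dist: "distinct [tail C e2, tail C e3, head C e3]"
    using x(2) by (auto simp: cr)
  have adj: "tail C e2 \<rightarrow>\<^bsub>C\<^esub> tail C e3" "tail C e3 \<rightarrow>\<^bsub>C\<^esub> head C e3"
    using arcs h2 by (metis C.in_arcs_imp_in_arcs_ends)+
  show thesis
    using that[OF _ _ _ dist] arcs adj adj_mono[OF _ sub] by auto
qed

lemma sccs_not_reachable:
  assumes "C \<in> sccs" "D \<in> sccs" "C \<noteq> D" "u \<in> verts C" "v \<in> verts D"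
  shows "\<not> u \<rightarrow>\<^sup>* v"
proof -
  have "verts C \<in> sccs_verts" using assms in_sccs_vertsI_sccs by blast
  moreover have "v \<notin> verts C" using assms scc_disj by blast
  ultimately show ?thesis
    using assms(4) symmetric_reachable' unfolding sccs_verts_def by blast
qed

end

lemma vertex_connectivity_le:
  assumes "finite S" "vertex_cutset \<Gamma> S"
  shows "vertex_connectivity \<Gamma> \<le> enat (card S)"
  unfolding vertex_connectivity_def
  by (rule INF_lower) (use assms in \<open>auto simp: vertex_cutset_def\<close>)

lemma cyclic_vertex_connectivity_le_enat_iff:
  "cyclic_vertex_connectivity \<Gamma> \<le> enat m \<longleftrightarrow> (\<exists>S. finite S \<and> cyclic_vertex_cutset \<Gamma> S \<and> card S \<le> m)"
proof -
  \<comment> \<open>A strict upper bound on an infimum yields a witness below it, so the weak bound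
    is first made strict.\<close>
  have "cyclic_vertex_connectivity \<Gamma> \<le> enat m \<longleftrightarrow> cyclic_vertex_connectivity \<Gamma> < enat (Suc m)"
    by (cases "cyclic_vertex_connectivity \<Gamma>") auto
  then show ?thesis
    unfolding cyclic_vertex_connectivity_def by (auto simp: INF_less_iff less_Suc_eq_le)
qed

section \<open>Power graphs of finite p-groups\<close>

context finite_p_group
begin

abbreviation deleted_power_graph :: "'a set \<Rightarrow> ('a, 'a \<times> 'a) pre_digraph" where
  "deleted_power_graph S \<equiv> delete_verts (power_graph G) S"

lemma int_pow_mem_cyclic_iff:
  "x \<in> carrier G \<Longrightarrow> (\<exists>k::int. y = x [^] k) \<longleftrightarrow> y \<in> generate G {x}"
  using generate_pow by auto

lemma verts_power_graph: "verts (power_graph G) = carrier G"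
  by (simp add: power_graph_def)

lemma verts_deleted: "verts (deleted_power_graph S) = carrier G - S"
  by (simp add: delete_verts_def verts_power_graph)

lemma adj_deleted_iff:
  "x \<rightarrow>\<^bsub>deleted_power_graph S\<^esub> y \<longleftrightarrow> x \<in> carrier G - S \<and> y \<in> carrier G - S \<and> x \<noteq> y \<and>
     (y \<in> generate G {x} \<or> x \<in> generate G {y})"
  by (auto simp: delete_verts_def power_graph_def arcs_ends_conv simp flip: int_pow_mem_cyclic_iff)

lemma sym_digraph_deleted: "sym_digraph (deleted_power_graph S)"
proof -
  have "wf_digraph (deleted_power_graph S)"
    by unfold_locales (auto simp: delete_verts_def)
  moreover have "symmetric (deleted_power_graph S)"
    unfolding symmetric_def by (rule symI) (auto simp: adj_deleted_iff)
  ultimately show ?thesis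
    by (simp add: sym_digraph_def sym_digraph_axioms_def)
qed

lemma comparable_reachable:
  assumes "x \<in> carrier G - S" "y \<in> carrier G - S" "y \<in> generate G {x} \<or> x \<in> generate G {y}"
  shows "x \<rightarrow>\<^sup>*\<^bsub>deleted_power_graph S\<^esub> y"
proof -
  interpret D: sym_digraph "deleted_power_graph S" by (rule sym_digraph_deleted)
  show ?thesis
    using assms by (cases "x = y") (auto simp: verts_deleted adj_deleted_iff)
qed

text \<open>A surviving vertex adjacent to all others would keep the graph connected; this bounds
  cutsets from below.\<close>

lemma dominating_mem_cutset:
  assumes "vertex_cutset (power_graph G) S" "d \<in> carrier G"
    "\<And>v. v \<in> carrier G \<Longrightarrow> v \<in> generate G {d} \<or> d \<in> generate G {v}"
  shows "d \<in> S"
proof (rule ccontr)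
  assume "d \<notin> S"
  interpret D: sym_digraph "deleted_power_graph S" by (rule sym_digraph_deleted)
  have "\<not> disconnected (deleted_power_graph S)"
    by (rule D.not_disconnected_if_dominating[of d])
       (use assms \<open>d \<notin> S\<close> in \<open>auto simp: verts_deleted adj_deleted_iff\<close>)
  then show False using assms(1) vertex_cutset_def by blast
qed

lemma one_mem_cutset: "vertex_cutset (power_graph G) S \<Longrightarrow> \<one> \<in> S"
  by (rule dominating_mem_cutset) (auto simp: generate.one)

lemma vertex_cutsetI:
  assumes "S \<subseteq> carrier G" "a \<in> carrier G - S" "b \<in> carrier G - S"
    "\<not> a \<rightarrow>\<^sup>*\<^bsub>deleted_power_graph S\<^esub> b"
  shows "vertex_cutset (power_graph G) S"
proof -
  interpret D: sym_digraph "deleted_power_graph S" by (rule sym_digraph_deleted)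
  show ?thesis
    using assms unfolding vertex_cutset_def disconnected_def D.connected_iff_reachable
    by (auto simp: verts_power_graph verts_deleted)
qed

lemma cyclic_vertex_cutset_paths:
  assumes "cyclic_vertex_cutset (power_graph G) S"
  obtains u v w u' v' w' where
    "distinct [u, v, w]" "u \<rightarrow>\<^bsub>deleted_power_graph S\<^esub> v" "v \<rightarrow>\<^bsub>deleted_power_graph S\<^esub> w"
    "distinct [u', v', w']" "u' \<rightarrow>\<^bsub>deleted_power_graph S\<^esub> v'" "v' \<rightarrow>\<^bsub>deleted_power_graph S\<^esub> w'"
    "\<And>x y. x \<in> {u, v, w} \<Longrightarrow> y \<in> {u', v', w'} \<Longrightarrow> \<not> x \<rightarrow>\<^sup>*\<^bsub>deleted_power_graph S\<^esub> y"
proof -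
  interpret D: sym_digraph "deleted_power_graph S" by (rule sym_digraph_deleted)
  obtain C C' where C: "C \<in> D.sccs" "C' \<in> D.sccs" "C \<noteq> C'" "contains_cycle C" "contains_cycle C'"
    using assms unfolding cyclic_vertex_cutset_def by blast
  obtain u v w where uvw: "u \<in> verts C" "v \<in> verts C" "w \<in> verts C" "distinct [u, v, w]"
    "u \<rightarrow>\<^bsub>deleted_power_graph S\<^esub> v" "v \<rightarrow>\<^bsub>deleted_power_graph S\<^esub> w"
    using D.ex_path_in_cyclic_scc C by metis
  obtain u' v' w' where uvw': "u' \<in> verts C'" "v' \<in> verts C'" "w' \<in> verts C'" "distinct [u', v', w']"
    "u' \<rightarrow>\<^bsub>deleted_power_graph S\<^esub> v'" "v' \<rightarrow>\<^bsub>deleted_power_graph S\<^esub> w'"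
    using D.ex_path_in_cyclic_scc C by metis
  show thesis
    using that[OF uvw(4-6) uvw'(4-6)] uvw(1-3) uvw'(1-3) D.sccs_not_reachable[OF C(1-3)] by blast
qed

text \<open>Sharing a nontrivial element \<open>c\<close> with \<open>generate G {a}\<close> passes
  along edges. It is clear when \<open>x\<close> is a power of \<open>y\<close>; when
  \<open>y\<close> is a power of \<open>x\<close>, the elements \<open>y\<close> and
  \<open>c\<close> lie in the same cyclic p-group and are comparable.\<close>

lemma not_reachable_without_one:
  assumes a: "a \<in> carrier G" "a \<noteq> \<one>" and b: "b \<in> carrier G"
    and triv: "generate G {a} \<inter> generate G {b} = {\<one>}"
  shows "\<not> a \<rightarrow>\<^sup>*\<^bsub>deleted_power_graph {\<one>}\<^esub> b"
proof
  interpret D: sym_digraph "deleted_power_graph {\<one>}" by (rule sym_digraph_deleted)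
  let ?P = "\<lambda>x. \<exists>c. c \<noteq> \<one> \<and> c \<in> generate G {a} \<and> c \<in> generate G {x}"
  assume "a \<rightarrow>\<^sup>*\<^bsub>deleted_power_graph {\<one>}\<^esub> b"
  then have "?P b"
  proof (rule D.reachable_invariant)
    show "?P a" using a self_mem_cyclic by blast
    fix x y assume xy: "x \<rightarrow>\<^bsub>deleted_power_graph {\<one>}\<^esub> y" and "?P x"
    then obtain c where c: "c \<noteq> \<one>" "c \<in> generate G {a}" "c \<in> generate G {x}" by blast
    have G: "x \<in> carrier G" "y \<in> carrier G" "y \<noteq> \<one>" using xy by (auto simp: adj_deleted_iff)
    consider "x \<in> generate G {y}" | "y \<in> generate G {x}" using xy by (auto simp: adj_deleted_iff)
    then show "?P y"
    proof cases
      case 1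
      then show ?thesis using c cyclic_subset G by blast
    next
      case 2
      then consider "y \<in> generate G {c}" | "c \<in> generate G {y}"
        using cyclic_comparable[OF G(1)] c by blast
      then show ?thesis
      proof cases
        case 1
        then have "y \<in> generate G {a}" using c(2) cyclic_subset a by blast
        then show ?thesis using G self_mem_cyclic by blast
      qed (use c in blast)
    qed
  qed
  then show False using triv by auto
qed

text \<open>The nontrivial elements of \<open>generate G {a}\<close> are pairwise adjacent, and from
  order 4 on there are three of them, enough for a triangle.\<close>

lemma ex_cyclic_component:
  assumes a: "a \<in> carrier G" "4 \<le> ord a"
  shows "\<exists>C\<in>pre_digraph.sccs (deleted_power_graph {\<one>}). a \<in> verts C \<and> contains_cycle C"
proof -
  interpret D: sym_digraph "deleted_power_graph {\<one>}" by (rule sym_digraph_deleted)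
  let ?A = "generate G {a} - {\<one>, a}"
  have sub: "generate G {a} \<subseteq> carrier G" using a mem_cyclic_carrier by blast
  have a1: "a \<noteq> \<one>" using a(2) by auto
  have "finite (generate G {a})" using sub finite_carrier finite_subset by blast
  then have "card ?A = ord a - 2"
    using a1 a(1) self_mem_cyclic generate.one[of G "{a}"] generate_pow_card[of a]
    by (simp add: card_Diff_subset)
  then have "\<not> card ?A \<le> 1" using a(2) by simp
  moreover have "finite ?A" using \<open>finite (generate G {a})\<close> by simp
  ultimately obtain b c where bc: "b \<in> ?A" "c \<in> ?A" "b \<noteq> c"
    using card_le_Suc0_iff_eq[of ?A] by auto
  have adj: "x \<rightarrow>\<^bsub>deleted_power_graph {\<one>}\<^esub> y"
    if "x \<in> generate G {a} - {\<one>}" "y \<in> generate G {a} - {\<one>}" "x \<noteq> y" for x y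
    using that sub cyclic_comparable[OF a(1), of x y] by (auto simp: adj_deleted_iff)
  show ?thesis
    by (rule D.ex_scc_with_triangle[of a b c]) (use adj bc a1 self_mem_cyclic[of a] in auto)
qed

text \<open>Both values are 1: deleting \<open>{\<one>}\<close> leaves two components with cycles,
  and every cutset contains the identity.\<close>

lemma connectivity_eq_if_trivial_intersection:
  assumes a: "a \<in> carrier G" "4 \<le> ord a" and b: "b \<in> carrier G" "4 \<le> ord b"
    and triv: "generate G {a} \<inter> generate G {b} = {\<one>}"
  shows "vertex_connectivity (power_graph G) = cyclic_vertex_connectivity (power_graph G)"
proof -
  interpret D: sym_digraph "deleted_power_graph {\<one>}" by (rule sym_digraph_deleted)
  have ab1: "a \<noteq> \<one>" "b \<noteq> \<one>" using a b by auto
  have nreach: "\<not> a \<rightarrow>\<^sup>*\<^bsub>deleted_power_graph {\<one>}\<^esub> b"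
    using not_reachable_without_one a(1) ab1(1) b(1) triv by blast
  have cut: "vertex_cutset (power_graph G) {\<one>}"
    by (rule vertex_cutsetI[OF _ _ _ nreach]) (use a b ab1 in auto)
  obtain A where A: "A \<in> D.sccs" "a \<in> verts A" "contains_cycle A" using ex_cyclic_component a by blast
  obtain B where B: "B \<in> D.sccs" "b \<in> verts B" "contains_cycle B" using ex_cyclic_component b by blast
  have "A \<noteq> B"
  proof
    assume "A = B"
    then have "a \<rightarrow>\<^sup>*\<^bsub>deleted_power_graph {\<one>}\<^esub> b"
      using A B D.in_sccs_vertsI_sccs[of "verts A"] unfolding D.sccs_verts_def by blast
    then show False using nreach by blast
  qed
  then have ccut: "cyclic_vertex_cutset (power_graph G) {\<one>}"
    unfolding cyclic_vertex_cutset_def using cut A B by blast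
  have "cyclic_vertex_connectivity (power_graph G) = 1"
  proof (rule antisym)
    show "cyclic_vertex_connectivity (power_graph G) \<le> 1"
      unfolding one_enat_def cyclic_vertex_connectivity_le_enat_iff
      using ccut by (intro exI[of _ "{\<one>}"]) simp
    show "1 \<le> cyclic_vertex_connectivity (power_graph G)"
      unfolding cyclic_vertex_connectivity_def
    proof (rule INF_greatest)
      fix S assume "S \<in> {S. finite S \<and> cyclic_vertex_cutset (power_graph G) S}"
      then have "finite S" "\<one> \<in> S" using one_mem_cutset by (auto simp: cyclic_vertex_cutset_def)
      then have "card S \<noteq> 0" by auto
      then show "1 \<le> enat (card S)" by (simp add: one_enat_def)
    qed
  qed
  moreover have "vertex_connectivity (power_graph G) = 1"
  proof (rule antisym)
    show "vertex_connectivity (power_graph G) \<le> 1"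
      using vertex_connectivity_le[OF _ cut] by (simp add: one_enat_def)
    show "1 \<le> vertex_connectivity (power_graph G)"
      unfolding vertex_connectivity_def
    proof (rule INF_greatest)
      fix S assume "S \<in> {S. finite S \<and> S \<subseteq> verts (power_graph G) \<and>
        (disconnected (deleted_power_graph S) \<or> card (verts (deleted_power_graph S)) = 1)}"
      then have S: "finite S" "vertex_cutset (power_graph G) S \<or> card (carrier G - S) = 1"
        by (auto simp: vertex_cutset_def verts_deleted)
      \<comment> \<open>Besides cutsets, sets leaving a single vertex count for the vertex
        connectivity; the empty set is not one of them, as the group has at least two
        elements.\<close>
      have "card {\<one>, a} \<le> card (carrier G)"
        using finite_carrier a by (intro card_mono) auto
      then have "card (carrier G - {}) \<noteq> 1" using ab1 by auto
      then have "S \<noteq> {}" using S(2) one_mem_cutset by auto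
      then have "card S \<noteq> 0" using S(1) by auto
      then show "1 \<le> enat (card S)" by (simp add: one_enat_def)
    qed
  qed
  ultimately show ?thesis by simp
qed

text \<open>The power graph is complete, so it has no cutsets at all and only the vertex
  connectivity is finite.\<close>

lemma connectivity_neq_if_cyclic:
  assumes "x \<in> carrier G" "carrier G = generate G {x}"
  shows "vertex_connectivity (power_graph G) \<noteq> cyclic_vertex_connectivity (power_graph G)"
proof
  assume eq: "vertex_connectivity (power_graph G) = cyclic_vertex_connectivity (power_graph G)"
  let ?S = "carrier G - {\<one>}"
  have "carrier G - ?S = {\<one>}" by auto
  then have "vertex_connectivity (power_graph G) \<le> enat (card ?S)"
    unfolding vertex_connectivity_def
    by (intro INF_lower) (auto simp: verts_power_graph verts_deleted finite_carrier)
  then obtain S where S: "cyclic_vertex_cutset (power_graph G) S"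
    using eq cyclic_vertex_connectivity_le_enat_iff by metis
  then have "d \<in> S" if "d \<in> carrier G" for d
    using dominating_mem_cutset[of S d] cyclic_comparable[OF assms(1)] assms(2) that
    unfolding cyclic_vertex_cutset_def by blast
  then have "verts (deleted_power_graph S) = {}" by (auto simp: verts_deleted)
  then show False
    using S unfolding cyclic_vertex_cutset_def vertex_cutset_def disconnected_def by blast
qed

section \<open>Cyclic subgroups as subgroups generated by one element\<close>

lemma generate_eq_range: "x \<in> carrier G \<Longrightarrow> generate G {x} = range (\<lambda>k::int. x [^] k)"
  by (auto simp: generate_pow)

lemma cyclic_subgroup_iff:
  "cyclic_subgroup H G \<longleftrightarrow> (\<exists>x\<in>carrier G. H = generate G {x})"
proof
  assume H: "cyclic_subgroup H G"
  then have sub: "subgroup H G" and cyc: "cyclic_group (G\<lparr>carrier := H\<rparr>)"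
    by (auto simp: cyclic_subgroup_def)
  interpret H: group "G\<lparr>carrier := H\<rparr>" using sub subgroup_imp_group by blast
  obtain x where x: "x \<in> H" "H = range (\<lambda>k::int. x [^]\<^bsub>G\<lparr>carrier := H\<rparr>\<^esub> k)"
    using cyc H.cyclic_group by auto
  then have "H = range (\<lambda>k::int. x [^] k)"
    using int_pow_consistent[OF sub x(1)] by simp
  moreover have xG: "x \<in> carrier G" by (rule subgroup.mem_carrier[OF sub x(1)])
  ultimately show "\<exists>x\<in>carrier G. H = generate G {x}"
    using generate_eq_range[OF xG] by blast
next
  assume "\<exists>x\<in>carrier G. H = generate G {x}"
  then obtain x where x: "x \<in> carrier G" "H = generate G {x}" by blast
  then have sub: "subgroup H G" using generate_is_subgroup by simp
  interpret H: group "G\<lparr>carrier := H\<rparr>" using sub subgroup_imp_group by blast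
  have "x \<in> H" using x self_mem_cyclic by simp
  moreover have "H = range (\<lambda>k::int. x [^]\<^bsub>G\<lparr>carrier := H\<rparr>\<^esub> k)"
    using x(2) generate_eq_range[OF x(1)] int_pow_consistent[OF sub \<open>x \<in> H\<close>] by simp
  ultimately have "cyclic_group (G\<lparr>carrier := H\<rparr>)"
    unfolding H.cyclic_group by auto
  then show "cyclic_subgroup H G" using sub cyclic_subgroup_def by blast
qed

lemma cyclic_group_iff:
  "cyclic_group G \<longleftrightarrow> (\<exists>x\<in>carrier G. carrier G = generate G {x})"
  unfolding cyclic_group using generate_eq_range by simp

lemma maximal_cyclic_subgroup_generate:
  assumes "max_cyclic c"
  shows "maximal_cyclic_subgroup (generate G {c}) G"
  using assms unfolding maximal_cyclic_subgroup_def cyclic_subgroup_iff max_cyclic_def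
  using mem_cyclic_iff_subset by (metis less_le_not_le)

text \<open>Adjacent elements of order \<open>p\<close> generate the same subgroup, so a path of
  three, together with the identity, would give four elements in a group of order at most 3.\<close>

lemma order_gt_p_in_path:
  assumes "p \<le> 3" "distinct [u, v, w]" "u \<rightarrow>\<^bsub>deleted_power_graph {\<one>}\<^esub> v" "v \<rightarrow>\<^bsub>deleted_power_graph {\<one>}\<^esub> w"
  obtains z where "z \<in> {u, v, w}" "z \<in> carrier G - {\<one>}" "p < ord z"
proof (rule ccontr)
  assume "\<not> thesis"
  then have le: "ord z \<le> p" if "z \<in> {u, v, w}" "z \<in> carrier G - {\<one>}" for z
    using \<open>\<And>z. z \<in> {u, v, w} \<Longrightarrow> z \<in> carrier G - {\<one>} \<Longrightarrow> p < ord z \<Longrightarrow> thesis\<close> that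
    by (meson not_le)
  have mem: "u \<in> carrier G" "v \<in> carrier G" "w \<in> carrier G" "u \<noteq> \<one>" "v \<noteq> \<one>" "w \<noteq> \<one>"
    using assms(3,4) by (auto simp: adj_deleted_iff)
  have ord: "ord z = p" if "z \<in> {u, v, w}" for z
  proof -
    have z: "z \<in> carrier G - {\<one>}" using that mem by auto
    then have "ord z \<le> p" using le that by blast
    moreover have "p \<le> ord z"
      using p_dvd_ord[of z] z ord_pos by (auto intro: dvd_imp_le)
    ultimately show ?thesis by simp
  qed
  have "u \<in> generate G {v}"
    using assms(3) ord_le_of_mem_cyclic(2)[OF mem(1), of v] ord by (auto simp: adj_deleted_iff)
  moreover have "w \<in> generate G {v}"
    using assms(4) ord_le_of_mem_cyclic(2)[OF mem(3), of v] ord by (auto simp: adj_deleted_iff)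
  ultimately have "{\<one>, u, v, w} \<subseteq> generate G {v}"
    using self_mem_cyclic[of v] generate.one[of G] by auto
  moreover have "finite (generate G {v})"
    using mem mem_cyclic_carrier finite_carrier by (meson finite_subset subsetI)
  ultimately have "card {\<one>, u, v, w} \<le> p"
    using card_mono generate_pow_card[OF mem(2)] ord[of v] by (metis insertI1 insertI2)
  moreover have "card {\<one>, u, v, w} = 4" using assms(2) mem by auto
  ultimately show False using assms(1) by simp
qed

text \<open>Two elements of order above \<open>p\<close> from different components are enlarged to
  generators \<open>c\<close>, \<open>d\<close> of maximal cyclic subgroups. A common nontrivial
  element \<open>z\<close> would join them by the route \<open>a\<close>, \<open>c\<close>,
  \<open>z\<close>, \<open>d\<close>, \<open>b\<close>.\<close>

lemma ex_maximal_cyclic_subgroups: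
  assumes "p \<le> 3" "cyclic_vertex_cutset (power_graph G) {\<one>}"
  shows "\<exists>M N. maximal_cyclic_subgroup M G \<and> maximal_cyclic_subgroup N G \<and> M \<noteq> N \<and>
    p < card M \<and> p < card N \<and> M \<inter> N = {\<one>}"
proof -
  interpret D: sym_digraph "deleted_power_graph {\<one>}" by (rule sym_digraph_deleted)
  obtain a b where ab: "a \<in> carrier G - {\<one>}" "p < ord a" "b \<in> carrier G - {\<one>}" "p < ord b"
    and nreach: "\<not> a \<rightarrow>\<^sup>*\<^bsub>deleted_power_graph {\<one>}\<^esub> b"
    using cyclic_vertex_cutset_paths[OF assms(2)] order_gt_p_in_path[OF assms(1)] by metis
  obtain c where c: "max_cyclic c" "a \<in> generate G {c}" using ex_max_cyclic ab by blast
  obtain d where d: "max_cyclic d" "b \<in> generate G {d}" using ex_max_cyclic ab by blast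
  have cd: "c \<in> carrier G" "d \<in> carrier G" using c d max_cyclic_def by auto
  have cd1: "c \<noteq> \<one>" "d \<noteq> \<one>" using ab c d generate_one by auto
  have card: "p < card (generate G {c})" "p < card (generate G {d})"
    using ord_le_of_mem_cyclic(1)[OF cd(1) c(2)] ord_le_of_mem_cyclic(1)[OF cd(2) d(2)] ab
      generate_pow_card cd by simp_all
  have triv: "generate G {c} \<inter> generate G {d} = {\<one>}"
  proof (rule ccontr)
    assume "generate G {c} \<inter> generate G {d} \<noteq> {\<one>}"
    then obtain z where z: "z \<in> generate G {c}" "z \<in> generate G {d}" "z \<noteq> \<one>"
      using generate.one[of G] by blast
    have zG: "z \<in> carrier G" using z cd mem_cyclic_carrier by blast
    have "a \<rightarrow>\<^sup>*\<^bsub>deleted_power_graph {\<one>}\<^esub> c" "c \<rightarrow>\<^sup>*\<^bsub>deleted_power_graph {\<one>}\<^esub> z"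
      "z \<rightarrow>\<^sup>*\<^bsub>deleted_power_graph {\<one>}\<^esub> d" "d \<rightarrow>\<^sup>*\<^bsub>deleted_power_graph {\<one>}\<^esub> b"
      using ab c(2) d(2) cd cd1 z zG by (auto intro!: comparable_reachable)
    then show False using nreach D.reachable_trans by metis
  qed
  then have "generate G {c} \<noteq> generate G {d}" using card prime_ge_1_nat[OF prime_p] by auto
  then show ?thesis using c d card triv maximal_cyclic_subgroup_generate by blast
qed

text \<open>Equality would force \<open>{\<one>, z}\<close> to be a cyclic cutset; but each
  component with a cycle contains a vertex of one fixed cyclic subgroup, whose elements are pairwise
  comparable.\<close>

lemma connectivity_neq_if_cyclics_meet_2:
  assumes meet: "cyclics_meet" "p = 2" and noncyclic: "\<not> cyclic_group G"
  shows "vertex_connectivity (power_graph G) \<noteq> cyclic_vertex_connectivity (power_graph G)"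
proof
  assume eq: "vertex_connectivity (power_graph G) = cyclic_vertex_connectivity (power_graph G)"
  have "carrier G \<noteq> {\<one>}" using noncyclic cyclic_group_iff generate_one by auto
  then obtain x0 where x0: "x0 \<in> carrier G" "x0 \<noteq> \<one>" by blast
  obtain x where x: "max_cyclic x" "x0 \<in> generate G {x}" using ex_max_cyclic x0 by blast
  have xG: "x \<in> carrier G" using x max_cyclic_def by blast
  have x1: "x \<noteq> \<one>" using x x0 generate_one by auto
  have "generate G {x} \<noteq> carrier G" using noncyclic cyclic_group_iff xG by auto
  then obtain y k where y: "y \<in> carrier G" "y \<notin> generate G {x}" "y [^] (2::nat) \<in> generate G {x}"
    "y \<otimes> x = x [^] (k::nat) \<otimes> y" using ex_normalizing_element xG meet(2) by blast
  define z where "z = y [^] (2::nat)"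
  have rel: "y [^] (4::nat) = \<one>" "z \<noteq> \<one>" "x [^] (2::nat) \<noteq> \<one>"
    unfolding z_def using quaternion_relations[OF meet x(1) x1 y] by blast+
  have zG: "z \<in> carrier G" using y z_def by simp
  have z2: "z [^] (2::nat) = \<one>" unfolding z_def using rel(1) y(1) by (simp add: nat_pow_pow)
  have dom: "v \<in> generate G {z} \<or> z \<in> generate G {v}" if "v \<in> carrier G" for v
    using order_p_mem_cyclic[OF meet(1) zG _ that] z2 meet(2) generate.one by blast
  \<comment> \<open>Such a \<open>v\<close> has order exactly 4 and square \<open>z\<close>, because
    \<open>z\<close> is the only involution.\<close>
  have order4: "generate G {v} \<subseteq> {\<one>, v, z, inv v}" "inv v \<noteq> v"
    if v: "v \<in> carrier G - {\<one>, z}" "v [^] (4::nat) = \<one>" for v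
  proof -
    have vG: "v \<in> carrier G" using v by blast
    have v2: "v [^] (2::nat) \<noteq> \<one>"
      using involution_unique[OF meet, of v z] v z2 rel(2) zG by blast
    have "(v [^] (2::nat)) [^] (2::nat) = \<one>" using v vG by (simp add: nat_pow_pow)
    then have vz: "v [^] (2::nat) = z"
      using involution_unique[OF meet, of "v [^] (2::nat)" z] v2 vG zG z2 rel(2) by simp
    have "v [^] (3::nat) \<otimes> v = v [^] (4::nat)"
      using nat_pow_Suc[of v 3] by simp
    then have "v [^] (3::nat) \<otimes> v = \<one>" using v by simp
    then have v3: "v [^] (3::nat) = inv v" using vG by (metis inv_equality nat_pow_closed)
    show "generate G {v} \<subseteq> {\<one>, v, z, inv v}"
    proof
      fix u assume "u \<in> generate G {v}"
      then obtain i :: nat where i: "u = v [^] i" using mem_cyclic_iff vG by blast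
      have "v [^] i = v [^] (i mod 4)"
        using pow_eq_pow_iff_cong[OF vG] v(2) pow_eq_id[OF vG] cong_dvd_modulus_nat by (metis cong_mod_right cong_refl)
      moreover have "i mod 4 \<in> {0, 1, 2, 3}" by auto
      ultimately show "u \<in> {\<one>, v, z, inv v}" using i vz v3 vG by auto
    qed
    show "inv v \<noteq> v" using v2 vG by (metis numeral_2_eq_2 nat_pow_Suc nat_pow_0 l_one r_inv)
  qed
  have xz: "x \<noteq> z" using rel(3) z2 by auto
  have yz: "y \<noteq> z" "y \<noteq> \<one>" using y(2,3) z_def generate.one[of G "{x}"] by auto
  have cut: "vertex_cutset (power_graph G) {\<one>, z}"
  proof (rule vertex_cutsetI[of _ y x])
    interpret D: sym_digraph "deleted_power_graph {\<one>, z}" by (rule sym_digraph_deleted)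
    show "\<not> y \<rightarrow>\<^sup>*\<^bsub>deleted_power_graph {\<one>, z}\<^esub> x"
    proof
      assume "y \<rightarrow>\<^sup>*\<^bsub>deleted_power_graph {\<one>, z}\<^esub> x"
      then have "y \<in> generate G {x}"
      \<comment> \<open>The property \<open>y \<in> generate G {v}\<close> persists along edges:
        when it is not immediate for the next vertex \<open>w\<close>, then \<open>w\<close> is a
        power of \<open>y\<close> other than \<open>\<one>\<close> and \<open>z\<close>, thus
        \<open>y\<close> or its inverse.\<close>
      proof (rule D.reachable_invariant)
        show "y \<in> generate G {y}" by (rule self_mem_cyclic)
        fix v w assume vw: "v \<rightarrow>\<^bsub>deleted_power_graph {\<one>, z}\<^esub> w" and yv: "y \<in> generate G {v}"
        then have G: "v \<in> carrier G" "w \<in> carrier G - {\<one>, z}" by (auto simp: adj_deleted_iff)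
        consider "v \<in> generate G {w}" | "w \<in> generate G {v}" using vw by (auto simp: adj_deleted_iff)
        then show "y \<in> generate G {w}"
        proof cases
          case 1
          then show ?thesis using yv cyclic_subset G by blast
        next
          case 2
          then consider "y \<in> generate G {w}" | "w \<in> generate G {y}"
            using cyclic_comparable[OF G(1)] yv by blast
          then show ?thesis
          proof cases
            case 2
            then have "w = y \<or> w = inv y" using order4(1)[of y] y(1) yz rel(1) G by auto
            moreover have "y \<in> generate G {inv y}"
              using generate.inv[of "inv y" "{inv y}" G] y(1) by simp
            ultimately show ?thesis using self_mem_cyclic by blast
          qed
        qed
      qed
      then show False using y(2) by blast
    qed
  qed (use xG y(1) zG xz yz x1 in auto)
  then have "vertex_connectivity (power_graph G) \<le> enat 2"
    using vertex_connectivity_le[OF _ cut] rel(2) by (simp add: numeral_2_eq_2)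
  then obtain S where S: "finite S" "cyclic_vertex_cutset (power_graph G) S" "card S \<le> 2"
    using eq cyclic_vertex_connectivity_le_enat_iff by metis
  then have vS: "vertex_cutset (power_graph G) S" by (simp add: cyclic_vertex_cutset_def)
  have "{\<one>, z} \<subseteq> S"
    using one_mem_cutset[OF vS] dominating_mem_cutset[OF vS zG] dom by blast
  then have Sz: "S = {\<one>, z}" using S rel(2) card_seteq[of S "{\<one>, z}"] by auto
  obtain c where c: "c \<in> carrier G"
    "\<And>w. w \<in> carrier G \<Longrightarrow> w \<notin> generate G {c} \<Longrightarrow> w [^] (4::nat) = \<one>"
    using ex_cyclic_pow_four_outside[OF meet] by blast
  \<comment> \<open>Outside \<open>generate G {c}\<close> all fourth powers are trivial, so both
    neighbours of \<open>v\<close> on the path would be its inverse.\<close>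
  have hit: "\<exists>t\<in>{u, v, w}. t \<in> carrier G - S \<and> t \<in> generate G {c}"
    if path: "distinct [u, v, w]" "u \<rightarrow>\<^bsub>deleted_power_graph S\<^esub> v" "v \<rightarrow>\<^bsub>deleted_power_graph S\<^esub> w" for u v w
  proof (rule ccontr)
    assume no: "\<not> ?thesis"
    have mem: "u \<in> carrier G - {\<one>, z}" "v \<in> carrier G - {\<one>, z}" "w \<in> carrier G - {\<one>, z}"
      using path Sz by (auto simp: adj_deleted_iff)
    have pow4: "u [^] (4::nat) = \<one>" "v [^] (4::nat) = \<one>" "w [^] (4::nat) = \<one>"
      using no mem c(2) Sz by auto
    have inv: "s = inv v" if s: "s \<in> carrier G - {\<one>, z}" "s [^] (4::nat) = \<one>" "s \<noteq> v"
      "s \<in> generate G {v} \<or> v \<in> generate G {s}" for s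
    proof -
      have "s = inv v \<or> v = inv s"
        using order4(1)[OF s(1,2)] order4(1)[OF mem(2) pow4(2)] s mem(2) by blast
      then show ?thesis using s mem by auto
    qed
    have "u = inv v" "w = inv v"
      using inv[OF mem(1) pow4(1)] inv[OF mem(3) pow4(3)] path by (auto simp: adj_deleted_iff)
    then show False using path(1) by simp
  qed
  obtain u v w u' v' w' where path:
    "distinct [u, v, w]" "u \<rightarrow>\<^bsub>deleted_power_graph S\<^esub> v" "v \<rightarrow>\<^bsub>deleted_power_graph S\<^esub> w" and path':
    "distinct [u', v', w']" "u' \<rightarrow>\<^bsub>deleted_power_graph S\<^esub> v'" "v' \<rightarrow>\<^bsub>deleted_power_graph S\<^esub> w'"
    and nreach: "\<And>x y. x \<in> {u, v, w} \<Longrightarrow> y \<in> {u', v', w'} \<Longrightarrow> \<not> x \<rightarrow>\<^sup>*\<^bsub>deleted_power_graph S\<^esub> y"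
    using cyclic_vertex_cutset_paths[OF S(2)] by blast
  obtain s where s: "s \<in> {u, v, w}" "s \<in> carrier G - S" "s \<in> generate G {c}"
    using hit[OF path] by blast
  obtain t where t: "t \<in> {u', v', w'}" "t \<in> carrier G - S" "t \<in> generate G {c}"
    using hit[OF path'] by blast
  show False
    using nreach[OF s(1) t(1)] comparable_reachable[OF s(2) t(2)]
      cyclic_comparable[OF c(1) s(3) t(3)] by blast
qed

end

section \<open>Assembling both directions of the equivalence\<close>

theorem theorem1p2:
  fixes G :: "('a, 'm) monoid_scheme" and p n :: nat
  assumes "Factorial_Ring.prime p"
    and "group G"
    and "finite (carrier G)"
    and "order G = p ^ n"
  shows "vertex_connectivity (power_graph G) = cyclic_vertex_connectivity (power_graph G) \<longleftrightarrow>
    (p > 3 \<and> \<not> cyclic_group G) \<or>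
    (p \<in> {2, 3} \<and>
     (\<exists>M N. maximal_cyclic_subgroup M G \<and> maximal_cyclic_subgroup N G \<and> M \<noteq> N \<and>
        card M > p \<and> card N > p \<and> M \<inter> N = {\<one>\<^bsub>G\<^esub>}))"
    (is "?eq \<longleftrightarrow> ?i \<or> ?ii")
proof -
  interpret finite_p_group G p n
    using assms by (simp add: finite_p_group_def finite_p_group_axioms_def)
  show ?thesis
  proof
    assume eq: ?eq
    then have noncyclic: "\<not> cyclic_group G"
      using connectivity_neq_if_cyclic cyclic_group_iff by blast
    show "?i \<or> ?ii"
    proof (cases "p > 3")
      case False
      then have p: "p \<in> {2, 3}" "p \<le> 3"
        using prime_ge_2_nat[OF prime_p] by auto
      have "\<not> cyclics_meet"
      proof
        assume meet: cyclics_meet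
        then have "\<not> odd p"
          using cyclic_if_cyclics_meet_odd noncyclic cyclic_group_iff by blast
        then have "p = 2" using p(1) by auto
        then show False using connectivity_neq_if_cyclics_meet_2 meet noncyclic eq by blast
      qed
      then obtain a b where ab: "a \<in> carrier G" "b \<in> carrier G" "a \<noteq> \<one>\<^bsub>G\<^esub>" "b \<noteq> \<one>\<^bsub>G\<^esub>"
        "generate G {a} \<inter> generate G {b} = {\<one>\<^bsub>G\<^esub>}"
        unfolding cyclics_meet_def by blast
      then have "vertex_cutset (power_graph G) {\<one>\<^bsub>G\<^esub>}"
        using vertex_cutsetI[of "{\<one>\<^bsub>G\<^esub>}" a b] not_reachable_without_one[of a b] by blast
      \<comment> \<open>With the assumed equality this bound gives a cyclic cutset of at most one
        vertex, which must be the identity.\<close>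
      then have "vertex_connectivity (power_graph G) \<le> enat 1"
        using vertex_connectivity_le[of "{\<one>\<^bsub>G\<^esub>}"] by fastforce
      then obtain S where S: "finite S" "cyclic_vertex_cutset (power_graph G) S" "card S \<le> 1"
        using eq cyclic_vertex_connectivity_le_enat_iff by metis
      then have "\<one>\<^bsub>G\<^esub> \<in> S" using one_mem_cutset by (simp add: cyclic_vertex_cutset_def)
      then have "S = {\<one>\<^bsub>G\<^esub>}" using S card_seteq[of S "{\<one>\<^bsub>G\<^esub>}"] by auto
      then show ?thesis using ex_maximal_cyclic_subgroups p S(2) by blast
    qed (use noncyclic in blast)
  next
    assume "?i \<or> ?ii"
    then consider ?i | ?ii by blast
    then show ?eq
    proof cases
      case 1
      then have "odd p" using prime_p prime_odd_nat by auto
      then have "\<not> cyclics_meet"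
        using 1 cyclic_if_cyclics_meet_odd cyclic_group_iff by blast
      then obtain a b where ab: "a \<in> carrier G" "b \<in> carrier G" "a \<noteq> \<one>\<^bsub>G\<^esub>" "b \<noteq> \<one>\<^bsub>G\<^esub>"
        "generate G {a} \<inter> generate G {b} = {\<one>\<^bsub>G\<^esub>}"
        unfolding cyclics_meet_def by blast
      then have "p \<le> ord a" "p \<le> ord b"
        using p_dvd_ord ord_pos by (auto intro!: dvd_imp_le)
      then show ?thesis
        using connectivity_eq_if_trivial_intersection ab 1 by simp
    next
      case 2
      then obtain M N where MN: "maximal_cyclic_subgroup M G" "maximal_cyclic_subgroup N G"
        "card M > p" "card N > p" "M \<inter> N = {\<one>\<^bsub>G\<^esub>}" by blast
      obtain a b where ab: "a \<in> carrier G" "M = generate G {a}" "b \<in> carrier G" "N = generate G {b}"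
        using MN(1,2) unfolding maximal_cyclic_subgroup_def cyclic_subgroup_iff by blast
      \<comment> \<open>The order is a proper multiple of \<open>p\<close>, hence at least 2 times
        2.\<close>
      have "4 \<le> ord x" if x: "x \<in> carrier G" "p < ord x" for x
      proof (rule ccontr)
        assume "\<not> 4 \<le> ord x"
        moreover have "p dvd ord x"
          using x p_dvd_ord prime_ge_1_nat[OF prime_p] by (cases "x = \<one>\<^bsub>G\<^esub>") auto
        then obtain k where k: "ord x = p * k" by blast
        have "2 * 2 \<le> p * k"
          using x(2) k prime_ge_2_nat[OF prime_p] by (intro mult_le_mono) (auto intro: Suc_leI)
        ultimately show False using k by simp
      qed
      then have "4 \<le> ord a" "4 \<le> ord b"
        using MN ab generate_pow_card by auto
      then show ?thesis
        using connectivity_eq_if_trivial_intersection ab MN(5) by blast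
    qed
  qed
qed

end
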